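(* For any bimatrix game $G$ and any polytope $P \subset \mathbb{R}^2$ with $NEP(G) \subset P$, there exists a bimatrix game $G'$ such that $NEP(G') = NEP(G)$ and $CEP(G') = P$.
   Context: A polytope in $\mathbb{R}^2$ is the convex hull of a finite set of points. A bimatrix game is a two-player finite game $G$: each player $i \in \{1,2\}$ has a nonempty finite pure strategy set $S_i$ and a payoff function $u_i : S := S_1 \times S_2 \to \mathbb{R}$. A correlated equilibrium of $G$ is a probability distribution $\mu$ on $S$ such that for every player $i$ and all $s_i, t_i \in S_i$, $\sum_{s_{-i} \in S_{-i}} \mu(s_i,s_{-i})\,[u_i(s_i,s_{-i}) - u_i(t_i,s_{-i})] \ge 0$, where $S_{-i}$ is the strategy set of the other player. For a probability distribution $\mu$ on $S$, $u_i(\mu) := \sum_{s \in S} \mu(s) u_i(s)$. $CEP(G) \subset \mathbb{R}^2$ denotes the set of all $(u_1(\mu),u_2(\mu))$ where $\mu$ is a correlated equilibrium of $G$. $NEP(G) \subset \mathbb{R}^2$ denotes the set of all pairs of expected payoffs of (mixed) Nash equilibria of $G$. *)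

theory Defs
  imports "HOL-Analysis.Analysis" "HOL-Probability.Probability_Mass_Function"
begin

(* The strategy sets are carriers inside the types 'a and 'b; payoff values outside
   strats1 G \<times> strats2 G are irrelevant, since only sums over that set occur below. *)
record ('a, 'b) bimatrix =
  strats1 :: "'a set"
  strats2 :: "'b set"
  payoff1 :: "'a \<times> 'b \<Rightarrow> real"
  payoff2 :: "'a \<times> 'b \<Rightarrow> real"

definition bimatrix_game :: "('a, 'b) bimatrix \<Rightarrow> bool" where
  "bimatrix_game G \<longleftrightarrow>
     finite (strats1 G) \<and> strats1 G \<noteq> {} \<and> finite (strats2 G) \<and> strats2 G \<noteq> {}"

definition profiles :: "('a, 'b) bimatrix \<Rightarrow> ('a \<times> 'b) set" where
  "profiles G = strats1 G \<times> strats2 G"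

(* Probability distributions on a finite set A are rendered as p :: 'a pmf with
   set_pmf p \<subseteq> A. *)
definition expected_payoff1 :: "('a, 'b) bimatrix \<Rightarrow> ('a \<times> 'b) pmf \<Rightarrow> real" where
  "expected_payoff1 G \<mu> = (\<Sum>s\<in>profiles G. pmf \<mu> s * payoff1 G s)"

definition expected_payoff2 :: "('a, 'b) bimatrix \<Rightarrow> ('a \<times> 'b) pmf \<Rightarrow> real" where
  "expected_payoff2 G \<mu> = (\<Sum>s\<in>profiles G. pmf \<mu> s * payoff2 G s)"

definition correlated_equilibrium :: "('a, 'b) bimatrix \<Rightarrow> ('a \<times> 'b) pmf \<Rightarrow> bool" where
  "correlated_equilibrium G \<mu> \<longleftrightarrow>
     set_pmf \<mu> \<subseteq> profiles G \<and>
     (\<forall>s\<in>strats1 G. \<forall>s'\<in>strats1 G.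
        (\<Sum>t\<in>strats2 G. pmf \<mu> (s, t) * (payoff1 G (s, t) - payoff1 G (s', t))) \<ge> 0) \<and>
     (\<forall>t\<in>strats2 G. \<forall>t'\<in>strats2 G.
        (\<Sum>s\<in>strats1 G. pmf \<mu> (s, t) * (payoff2 G (s, t) - payoff2 G (s, t'))) \<ge> 0)"

(* Independent mixing of \<sigma> and \<tau> is the product distribution pair_pmf \<sigma> \<tau>. *)
definition nash_equilibrium :: "('a, 'b) bimatrix \<Rightarrow> 'a pmf \<Rightarrow> 'b pmf \<Rightarrow> bool" where
  "nash_equilibrium G \<sigma> \<tau> \<longleftrightarrow>
     set_pmf \<sigma> \<subseteq> strats1 G \<and> set_pmf \<tau> \<subseteq> strats2 G \<and>
     (\<forall>\<sigma>'. set_pmf \<sigma>' \<subseteq> strats1 G \<longrightarrow>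
        expected_payoff1 G (pair_pmf \<sigma>' \<tau>) \<le> expected_payoff1 G (pair_pmf \<sigma> \<tau>)) \<and>
     (\<forall>\<tau>'. set_pmf \<tau>' \<subseteq> strats2 G \<longrightarrow>
        expected_payoff2 G (pair_pmf \<sigma> \<tau>') \<le> expected_payoff2 G (pair_pmf \<sigma> \<tau>))"

definition CEP :: "('a, 'b) bimatrix \<Rightarrow> (real \<times> real) set" where
  "CEP G = {(expected_payoff1 G \<mu>, expected_payoff2 G \<mu>) | \<mu>. correlated_equilibrium G \<mu>}"

definition NEP :: "('a, 'b) bimatrix \<Rightarrow> (real \<times> real) set" where
  "NEP G = {(expected_payoff1 G (pair_pmf \<sigma> \<tau>), expected_payoff2 G (pair_pmf \<sigma> \<tau>)) | \<sigma> \<tau>.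
     nash_equilibrium G \<sigma> \<tau>}"

end

theory Submission imports Defs begin

text \<open>The set of Nash payoffs is a nonempty finite union of rectangles: once the supports are bounded
  above by \<open>A\<close>, \<open>B\<close> and the best-reply sets are bounded below by \<open>A\<close>, \<open>B\<close>, the payoff of each player
  depends only on the opponent's strategy, and the conditions on the two strategies decouple.

  Conversely, let every pure strategy belong to a block, and let the payoff of a player be a term
  chosen by the opponent plus a bonus. The two bonuses have a sum that is at most \<open>0\<close> and is negative
  off the diagonal blocks. Each player has a strategy with bonus \<open>0\<close> against everything, so in a
  correlated equilibrium all expected bonuses vanish and the play stays on the diagonal blocks, where
  the payoffs are those of the rectangle or of the vertex of the polytope that the block encodes. In
  a rectangle block all bonuses are \<open>0\<close>, so every pair of strategies is an equilibrium. In a vertex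
  block the bonuses are those of rock-paper-scissors with a loss for both players at ties: the
  uniform distribution off the ties is a correlated equilibrium, but there is no Nash equilibrium,
  since a product distribution that avoids ties leaves one of the players with a pure strategy,
  against which the other one has a nonzero bonus.\<close>

section \<open>Brouwer's theorem for a cube indexed by a finite set\<close>

text \<open>Bolzano-Weierstrass for bare functions on a finite carrier: the coordinates are added
  one at a time, and each thins out the subsequence found so far.\<close>

lemma pointwise_convergent_subsequence:
  fixes X :: "nat \<Rightarrow> 'i \<Rightarrow> real"
  assumes "finite I" and "\<And>k i. i \<in> I \<Longrightarrow> X k i \<in> {0..1}"
  obtains l r where "strict_mono (r :: nat \<Rightarrow> nat)"
    and "\<And>i. i \<in> I \<Longrightarrow> (\<lambda>k. X (r k) i) \<longlonglongrightarrow> l i"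
proof -
  have "\<exists>l r. strict_mono (r :: nat \<Rightarrow> nat) \<and> (\<forall>i\<in>I. (\<lambda>k. X (r k) i) \<longlonglongrightarrow> l i)"
    using assms
  proof (induction I rule: finite_induct)
    case empty
    show ?case by (auto intro!: exI[of _ id] simp: strict_mono_def)
  next
    case (insert a I)
    then obtain l r where r: "strict_mono (r :: nat \<Rightarrow> nat)"
      and l: "\<forall>i\<in>I. (\<lambda>k. X (r k) i) \<longlonglongrightarrow> l i"
      by auto
    have "\<forall>k. X (r k) a \<in> {0..1}" using insert.prems by blast
    then obtain b q where q: "strict_mono (q :: nat \<Rightarrow> nat)" "((\<lambda>k. X (r k) a) \<circ> q) \<longlonglongrightarrow> b"
      using compact_Icc[of 0 "1::real"] unfolding compact_def by metis
    have "(\<lambda>k. X ((r \<circ> q) k) i) \<longlonglongrightarrow> (l(a := b)) i" if "i \<in> insert a I" for i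
    proof (cases "i = a")
      case True
      then show ?thesis using q by (simp add: o_def)
    next
      case False
      then have "(\<lambda>k. X (r k) i) \<longlonglongrightarrow> l i" using l that by auto
      from LIMSEQ_subseq_LIMSEQ[OF this q(1)] show ?thesis using False by (simp add: o_def)
    qed
    then show ?case using strict_mono_o[OF r q(1)] by blast
  qed
  then show ?thesis using that by blast
qed

text \<open>Kuhn's combinatorial lemma on the grid of mesh \<open>1 / p\<close> gives a small cube
  in which, for each coordinate, one vertex is moved weakly up and another weakly down. The vertices
  may differ from coordinate to coordinate. Continuity enters only in the limit.\<close>

lemma brouwer_cube_approx:
  fixes f :: "('i \<Rightarrow> real) \<Rightarrow> 'i \<Rightarrow> real" and p :: nat
  assumes "finite I" and "p > 0"
    and range: "\<And>x i. (\<And>j. j \<in> I \<Longrightarrow> x j \<in> {0..1}) \<Longrightarrow> i \<in> I \<Longrightarrow> f x i \<in> {0..1}"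
  obtains x where "\<And>j. j \<in> I \<Longrightarrow> x j \<in> {0..1}"
    and "\<And>i. i \<in> I \<Longrightarrow> \<exists>r. (\<forall>j\<in>I. r j \<in> {0..1} \<and> \<bar>r j - x j\<bar> \<le> 1 / p) \<and> r i \<le> f r i"
    and "\<And>i. i \<in> I \<Longrightarrow> \<exists>s. (\<forall>j\<in>I. s j \<in> {0..1} \<and> \<bar>s j - x j\<bar> \<le> 1 / p) \<and> f s i \<le> s i"
proof -
  define n where "n = card I"
  obtain h where h: "bij_betw h I {..<n}"
    using ex_bij_betw_finite_nat[OF \<open>finite I\<close>] by (auto simp: n_def atLeast0LessThan)
  define e where "e = inv_into I h"
  have hI: "h i < n" if "i \<in> I" for i using h that by (auto simp: bij_betw_def)
  have eI: "e m \<in> I" "h (e m) = m" if "m < n" for m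
    using h that by (auto simp: e_def bij_betw_def inv_into_into f_inv_into_f)
  have eh: "e (h i) = i" if "i \<in> I" for i
    using h that by (simp add: e_def bij_betw_def)
  define g where "g y = (\<lambda>i. real (y (h i)) / p)" for y :: "nat \<Rightarrow> nat"
  \<comment> \<open>Label 0 stands for a coordinate that \<open>f\<close> moves weakly up, label 1
    for one that it moves weakly down. Kuhn's lemma prescribes 0 on the face \<open>0\<close> and 1
    on the face \<open>p\<close>; both agree with the direction of \<open>f\<close>, whose values
    stay in the unit interval.\<close>
  define label where "label y m = (if y m \<noteq> p \<and> (y m = 0 \<or> g y (e m) \<le> f (g y) (e m)) then 0 else 1 :: nat)"
    for y m
  have g01: "g y j \<in> {0..1}" if "\<forall>m<n. y m \<le> p" "j \<in> I" for y j
    using that hI[of j] \<open>p > 0\<close> by (auto simp: g_def divide_simps)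
  have fg01: "f (g y) (e m) \<in> {0..1}" if "\<forall>m<n. y m \<le> p" "m < n" for y m
    using range[of "g y" "e m"] g01[OF that(1)] eI[OF that(2)] by blast
  obtain q where q: "\<forall>m<n. q m < p"
    "\<forall>m<n. \<exists>r s. (\<forall>j<n. q j \<le> r j \<and> r j \<le> q j + 1) \<and> (\<forall>j<n. q j \<le> s j \<and> s j \<le> q j + 1) \<and>
            label r m \<noteq> label s m"
    by (rule kuhn_lemma[of p n label]) (use \<open>p > 0\<close> in \<open>auto simp: label_def\<close>)
  have lab0: "g y (e m) \<le> f (g y) (e m)" if "\<forall>m<n. y m \<le> p" "m < n" "label y m = 0" for y m
    using that fg01[OF that(1,2)] eI[OF that(2)] by (auto simp: label_def g_def split: if_splits)
  have lab1: "f (g y) (e m) \<le> g y (e m)" if "\<forall>m<n. y m \<le> p" "m < n" "label y m \<noteq> 0" for y m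
    using that fg01[OF that(1,2)] eI[OF that(2)] \<open>p > 0\<close> by (auto simp: label_def g_def split: if_splits)
  have both: "(\<exists>r. (\<forall>j\<in>I. r j \<in> {0..1} \<and> \<bar>r j - g q j\<bar> \<le> 1 / p) \<and> r i \<le> f r i) \<and>
    (\<exists>s. (\<forall>j\<in>I. s j \<in> {0..1} \<and> \<bar>s j - g q j\<bar> \<le> 1 / p) \<and> f s i \<le> s i)" if i: "i \<in> I" for i
  proof -
    obtain r s where rs: "\<forall>j<n. q j \<le> r j \<and> r j \<le> q j + 1" "\<forall>j<n. q j \<le> s j \<and> s j \<le> q j + 1"
      "label r (h i) \<noteq> label s (h i)"
      using q(2) hI[OF i] by blast
    have near: "(\<forall>m<n. y m \<le> p) \<and> (\<forall>j\<in>I. g y j \<in> {0..1} \<and> \<bar>g y j - g q j\<bar> \<le> 1 / p)"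
      if "\<forall>j<n. q j \<le> y j \<and> y j \<le> q j + 1" for y
    proof -
      have le: "\<forall>m<n. y m \<le> p"
      proof (intro allI impI)
        fix m assume "m < n"
        then show "y m \<le> p" using that q(1) by (metis Suc_eq_plus1 Suc_leI le_trans)
      qed
      have "\<bar>g y j - g q j\<bar> \<le> 1 / p" if "j \<in> I" for j
      proof -
        have "q (h j) \<le> y (h j)" "y (h j) \<le> q (h j) + 1"
          using \<open>\<forall>j<n. q j \<le> y j \<and> y j \<le> q j + 1\<close> hI[OF that] by auto
        then have "\<bar>real (y (h j)) - real (q (h j))\<bar> \<le> 1" by linarith
        then show ?thesis
          using \<open>p > 0\<close> by (simp add: g_def flip: diff_divide_distrib) (simp add: divide_right_mono)
      qed
      with le g01 show ?thesis by blast
    qed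
    have "label r (h i) = 0 \<or> label s (h i) = 0" using rs(3) by (auto simp: label_def split: if_splits)
    then obtain r' s' where rs': "\<forall>j<n. q j \<le> r' j \<and> r' j \<le> q j + 1" "\<forall>j<n. q j \<le> s' j \<and> s' j \<le> q j + 1"
      "label r' (h i) = 0" "label s' (h i) \<noteq> 0"
      using rs by metis
    have "g r' i \<le> f (g r') i" "f (g s') i \<le> g s' i"
      using lab0[of r' "h i"] lab1[of s' "h i"] near[OF rs'(1)] near[OF rs'(2)] rs'(3,4) hI[OF i] eh[OF i]
      by auto
    then show ?thesis using near[OF rs'(1)] near[OF rs'(2)] by blast
  qed
  show thesis
    by (rule that[of "g q"]) (use both g01 q(1) less_imp_le in \<open>blast+\<close>)
qed

text \<open>A cluster point of the approximate solutions is fixed: for each coordinate, the vertices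
  moved up and those moved down both converge to it, which gives the two inequalities. Continuity is
  sequential and coordinatewise because points are bare functions.\<close>

lemma brouwer_cube_finite:
  fixes f :: "('i \<Rightarrow> real) \<Rightarrow> 'i \<Rightarrow> real"
  assumes "finite I"
    and range: "\<And>x i. (\<And>j. j \<in> I \<Longrightarrow> x j \<in> {0..1}) \<Longrightarrow> i \<in> I \<Longrightarrow> f x i \<in> {0..1}"
    and cont: "\<And>X x i. (\<And>k j. j \<in> I \<Longrightarrow> X k j \<in> {0..1}) \<Longrightarrow>
      (\<And>j. j \<in> I \<Longrightarrow> (\<lambda>k. X k j) \<longlonglongrightarrow> x j) \<Longrightarrow> i \<in> I \<Longrightarrow> (\<lambda>k::nat. f (X k) i) \<longlonglongrightarrow> f x i"
  obtains x where "\<And>i. i \<in> I \<Longrightarrow> x i \<in> {0..1}" and "\<And>i. i \<in> I \<Longrightarrow> f x i = x i"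
proof -
  have "\<exists>x. \<forall>i\<in>I. x i \<in> {0..1} \<and>
      (\<exists>r. (\<forall>j\<in>I. r j \<in> {0..1} \<and> \<bar>r j - x j\<bar> \<le> 1 / real (Suc k)) \<and> r i \<le> f r i) \<and>
      (\<exists>s. (\<forall>j\<in>I. s j \<in> {0..1} \<and> \<bar>s j - x j\<bar> \<le> 1 / real (Suc k)) \<and> f s i \<le> s i)" for k
    by (rule brouwer_cube_approx[of I "Suc k" f, OF \<open>finite I\<close> _ range]) blast+
  then obtain X where X: "\<And>k. \<forall>i\<in>I. X k i \<in> {0..1} \<and>
      (\<exists>r. (\<forall>j\<in>I. r j \<in> {0..1} \<and> \<bar>r j - X k j\<bar> \<le> 1 / real (Suc k)) \<and> r i \<le> f r i) \<and>
      (\<exists>s. (\<forall>j\<in>I. s j \<in> {0..1} \<and> \<bar>s j - X k j\<bar> \<le> 1 / real (Suc k)) \<and> f s i \<le> s i)"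
    by metis
  then have X01: "\<And>k j. j \<in> I \<Longrightarrow> X k j \<in> {0..1}" by blast
  obtain x \<phi> where \<phi>: "strict_mono (\<phi> :: nat \<Rightarrow> nat)" and x: "\<And>j. j \<in> I \<Longrightarrow> (\<lambda>k. X (\<phi> k) j) \<longlonglongrightarrow> x j"
  proof (rule pointwise_convergent_subsequence[of I X])
    show "finite I" by fact
    show "\<And>k i. i \<in> I \<Longrightarrow> X k i \<in> {0..1}" by (rule X01)
  qed blast
  have near_lim: "(\<lambda>k. R (\<phi> k) j) \<longlonglongrightarrow> x j"
    if "j \<in> I" "\<And>k. \<bar>R k j - X k j\<bar> \<le> 1 / real (Suc k)" for R j
  proof -
    have "(\<lambda>k. R k j - X k j) \<longlonglongrightarrow> 0"
    proof (rule Lim_null_comparison)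
      show "\<forall>\<^sub>F k in sequentially. norm (R k j - X k j) \<le> 1 / real (Suc k)" using that(2) by simp
      show "(\<lambda>k. 1 / real (Suc k)) \<longlonglongrightarrow> 0" using LIMSEQ_Suc[OF lim_1_over_n] by simp
    qed
    from LIMSEQ_subseq_LIMSEQ[OF this \<phi>] have "(\<lambda>k. R (\<phi> k) j - X (\<phi> k) j) \<longlonglongrightarrow> 0"
      by (simp add: o_def)
    from tendsto_add[OF this x[OF that(1)]] show ?thesis by simp
  qed
  have "x i \<in> {0..1}" if "i \<in> I" for i
    by (rule closed_sequentially[OF closed_atLeastAtMost _ x[OF that]]) (rule X01[OF that])
  moreover have "f x i = x i" if i: "i \<in> I" for i
  proof -
    \<comment> \<open>The two vertices depend on the coordinate, so their sequences are chosen after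
      \<open>i\<close> has been fixed.\<close>
    have "\<forall>k. \<exists>r. (\<forall>j\<in>I. r j \<in> {0..1} \<and> \<bar>r j - X k j\<bar> \<le> 1 / real (Suc k)) \<and> r i \<le> f r i"
      using X i by blast
    from choice[OF this] obtain R where
      R: "\<And>k j. j \<in> I \<Longrightarrow> R k j \<in> {0..1}" "\<And>k j. j \<in> I \<Longrightarrow> \<bar>R k j - X k j\<bar> \<le> 1 / real (Suc k)" "\<And>k. R k i \<le> f (R k) i"
      by blast
    have "\<forall>k. \<exists>s. (\<forall>j\<in>I. s j \<in> {0..1} \<and> \<bar>s j - X k j\<bar> \<le> 1 / real (Suc k)) \<and> f s i \<le> s i"
      using X i by blast
    from choice[OF this] obtain S where
      S: "\<And>k j. j \<in> I \<Longrightarrow> S k j \<in> {0..1}" "\<And>k j. j \<in> I \<Longrightarrow> \<bar>S k j - X k j\<bar> \<le> 1 / real (Suc k)" "\<And>k. f (S k) i \<le> S k i"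
      by blast
    have R': "(\<lambda>k. R (\<phi> k) j) \<longlonglongrightarrow> x j" and S': "(\<lambda>k. S (\<phi> k) j) \<longlonglongrightarrow> x j" if "j \<in> I" for j
      using near_lim[of j R, OF that R(2)[OF that]] near_lim[of j S, OF that S(2)[OF that]] .
    have "x i \<le> f x i"
      by (rule LIMSEQ_le[OF R'[OF i] cont[of "\<lambda>k. R (\<phi> k)" x i]]) (use R R' i in blast)+
    moreover have "f x i \<le> x i"
      by (rule LIMSEQ_le[OF cont[of "\<lambda>k. S (\<phi> k)" x i] S'[OF i]]) (use S S' i in blast)+
    ultimately show ?thesis by simp
  qed
  ultimately show ?thesis using that by blast
qed

section \<open>Existence of Nash equilibria\<close>

text \<open>Members are arbitrary outside \<open>S\<close>, so that half of a fixed point of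
  Brouwer's map and the mass function of a distribution can be treated alike.\<close>

definition simplex_on :: "'i set \<Rightarrow> ('i \<Rightarrow> real) set" where
  "simplex_on S = {x. (\<forall>s\<in>S. 0 \<le> x s) \<and> sum x S = 1}"

lemma pmf_of_simplex_on:
  assumes "finite S" "x \<in> simplex_on S"
  obtains p where "set_pmf p \<subseteq> S" "\<And>s. s \<in> S \<Longrightarrow> pmf p s = x s"
proof -
  define f where "f s = (if s \<in> S then x s else 0)" for s
  have nn: "\<And>s. 0 \<le> f s" using assms by (auto simp: f_def simplex_on_def)
  have "(\<integral>\<^sup>+s. ennreal (f s) \<partial>count_space UNIV) = (\<Sum>s\<in>S. ennreal (f s))"
    by (rule nn_integral_count_space'[OF \<open>finite S\<close>]) (auto simp: f_def)
  also have "\<dots> = ennreal (\<Sum>s\<in>S. f s)" using nn by (simp add: sum_ennreal)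
  also have "(\<Sum>s\<in>S. f s) = 1" using assms by (simp add: f_def simplex_on_def)
  finally have "(\<integral>\<^sup>+s. ennreal (f s) \<partial>count_space UNIV) = 1" by simp
  note e = pmf_embed_pmf[of f, OF nn this] set_embed_pmf[of f, OF nn this]
  show ?thesis
  proof (rule that[of "embed_pmf f"])
    show "set_pmf (embed_pmf f) \<subseteq> S" using e(2) by (auto simp: f_def split: if_splits)
    show "pmf (embed_pmf f) s = x s" if "s \<in> S" for s using e(1) that by (simp add: f_def)
  qed
qed

lemma pmf_in_simplex_on:
  assumes "finite S" "set_pmf p \<subseteq> S"
  shows "pmf p \<in> simplex_on S"
  using sum_pmf_eq_1[OF assms] by (simp add: simplex_on_def)

text \<open>A continuous retraction of the nonnegative orthant onto the simplex: a total above 1 is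
  scaled down, a deficit is spread evenly. It carries Brouwer's theorem from the cube to the
  simplex.\<close>

definition simplex_retract :: "'i set \<Rightarrow> ('i \<Rightarrow> real) \<Rightarrow> 'i \<Rightarrow> real" where
  "simplex_retract S x s = x s / max 1 (sum x S) + max 0 (1 - sum x S) / card S"

lemma simplex_retract_in:
  assumes "finite S" "S \<noteq> {}" "\<And>s. s \<in> S \<Longrightarrow> 0 \<le> x s"
  shows "simplex_retract S x \<in> simplex_on S"
proof -
  have "sum (simplex_retract S x) S = sum x S / max 1 (sum x S) + max 0 (1 - sum x S)"
    using assms by (simp add: simplex_retract_def sum.distrib flip: sum_divide_distrib)
  also have "\<dots> = 1" by (auto simp: max_def)
  finally show ?thesis using assms by (auto simp: simplex_on_def simplex_retract_def)
qed

lemma simplex_retract_id: "x \<in> simplex_on S \<Longrightarrow> simplex_retract S x s = x s"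
  by (simp add: simplex_on_def simplex_retract_def)

section \<open>Nash's improvement map\<close>

definition excess :: "'i set \<Rightarrow> ('i \<Rightarrow> real) \<Rightarrow> ('i \<Rightarrow> real) \<Rightarrow> 'i \<Rightarrow> real" where
  "excess S y v s = max 0 (v s - (\<Sum>i\<in>S. y i * v i))"

text \<open>Weight moves towards the pure strategies whose value exceeds the current average. The
  total excess is nonnegative, so the denominator is at least 1 and continuity is
  unproblematic.\<close>

definition nash_map :: "'i set \<Rightarrow> ('i \<Rightarrow> real) \<Rightarrow> ('i \<Rightarrow> real) \<Rightarrow> 'i \<Rightarrow> real" where
  "nash_map S y v s = (y s + excess S y v s) / (1 + sum (excess S y v) S)"

lemma sum_excess_nonneg: "0 \<le> sum (excess S y v) S"
  by (intro sum_nonneg) (simp add: excess_def)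

lemma nash_map_in:
  assumes "y \<in> simplex_on S"
  shows "nash_map S y v \<in> simplex_on S"
proof -
  have "sum (nash_map S y v) S = (1 + sum (excess S y v) S) / (1 + sum (excess S y v) S)"
    using assms by (simp add: nash_map_def simplex_on_def sum.distrib flip: sum_divide_distrib)
  also have "\<dots> = 1" using sum_excess_nonneg[of S y v] by simp
  finally show ?thesis
    using assms sum_excess_nonneg[of S y v] by (auto simp: simplex_on_def nash_map_def excess_def)
qed

text \<open>Not every strategy of positive weight can lie strictly above the average, so one of them
  has excess 0. The fixed-point equation at that strategy forces the total excess to vanish.\<close>

lemma nash_map_fixpoint:
  assumes "finite S" "y \<in> simplex_on S" and fp: "\<And>s. s \<in> S \<Longrightarrow> nash_map S y v s = y s" and "s \<in> S"
  shows "v s \<le> (\<Sum>i\<in>S. y i * v i)"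
proof -
  let ?m = "\<Sum>i\<in>S. y i * v i"
  have y: "\<And>s. s \<in> S \<Longrightarrow> 0 \<le> y s" "sum y S = 1" using assms by (auto simp: simplex_on_def)
  have "(\<Sum>i\<in>S. y i * (v i - ?m)) = 0"
    using y(2) by (simp add: algebra_simps sum_subtractf flip: sum_distrib_left sum_distrib_right)
  have "\<exists>i\<in>S. 0 < y i \<and> v i \<le> ?m"
  proof (rule ccontr)
    assume *: "\<not> ?thesis"
    have pos: "0 < v i - ?m" if "i \<in> S" "y i \<noteq> 0" for i
      using * y(1)[OF that(1)] that by force
    have "0 \<le> y i * (v i - ?m)" if "i \<in> S" for i
      using pos[OF that] y(1)[OF that] by (cases "y i = 0") auto
    with \<open>(\<Sum>i\<in>S. y i * (v i - ?m)) = 0\<close> have "\<forall>i\<in>S. y i * (v i - ?m) = 0"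
      using \<open>finite S\<close> by (subst (asm) sum_nonneg_eq_0_iff) auto
    then have "\<forall>i\<in>S. y i = 0" using pos by fastforce
    with y(2) show False by simp
  qed
  then obtain i where i: "i \<in> S" "0 < y i" "v i \<le> ?m" by blast
  have pos: "0 < 1 + sum (excess S y v) S" using sum_excess_nonneg[of S y v] by linarith
  \<comment> \<open>The excess of \<open>i\<close> is 0, so the map merely divides the positive
    weight \<open>y i\<close> by the denominator, which must therefore be 1.\<close>
  have "y i / (1 + sum (excess S y v) S) = y i" using fp[OF i(1)] i(3) by (simp add: nash_map_def excess_def)
  then have "sum (excess S y v) S = 0" using i(2) pos by (simp add: field_simps)
  then have "excess S y v s = 0"
    using \<open>finite S\<close> \<open>s \<in> S\<close> by (subst (asm) sum_nonneg_eq_0_iff) (auto simp: excess_def)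
  then show ?thesis by (simp add: excess_def)
qed

lemma tendsto_simplex_retract:
  assumes "\<And>s. s \<in> S \<Longrightarrow> (\<lambda>k. X k s) \<longlonglongrightarrow> x s" and "s \<in> S"
  shows "(\<lambda>k. simplex_retract S (X k) s) \<longlonglongrightarrow> simplex_retract S x s"
  unfolding simplex_retract_def
  using assms by (cases "card S = 0") (auto intro!: tendsto_intros tendsto_sum tendsto_max)

lemma tendsto_nash_map:
  assumes "\<And>s. s \<in> S \<Longrightarrow> (\<lambda>k. Y k s) \<longlonglongrightarrow> y s" "\<And>s. s \<in> S \<Longrightarrow> (\<lambda>k. V k s) \<longlonglongrightarrow> v s" and "s \<in> S"
  shows "(\<lambda>k. nash_map S (Y k) (V k) s) \<longlonglongrightarrow> nash_map S y v s"
proof -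
  have "(\<lambda>k. excess S (Y k) (V k) s) \<longlonglongrightarrow> excess S y v s" if "s \<in> S" for s
    unfolding excess_def using assms that by (auto intro!: tendsto_intros tendsto_max)
  then show ?thesis unfolding nash_map_def
    using assms sum_excess_nonneg[of S y v]
    by (intro tendsto_divide tendsto_add tendsto_sum tendsto_const) auto
qed

section \<open>Best replies and the existence theorem\<close>

definition reply_payoff1 :: "('a, 'b) bimatrix \<Rightarrow> ('b \<Rightarrow> real) \<Rightarrow> 'a \<Rightarrow> real" where
  "reply_payoff1 G y s = (\<Sum>t\<in>strats2 G. y t * payoff1 G (s, t))"

definition reply_payoff2 :: "('a, 'b) bimatrix \<Rightarrow> ('a \<Rightarrow> real) \<Rightarrow> 'b \<Rightarrow> real" where
  "reply_payoff2 G x t = (\<Sum>s\<in>strats1 G. x s * payoff2 G (s, t))"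

lemma expected_payoff1_pair:
  "expected_payoff1 G (pair_pmf \<sigma> \<tau>) = (\<Sum>s\<in>strats1 G. pmf \<sigma> s * reply_payoff1 G (pmf \<tau>) s)"
  unfolding expected_payoff1_def profiles_def reply_payoff1_def
  by (simp add: sum.cartesian_product' pmf_pair sum_distrib_left mult.assoc)

lemma expected_payoff2_pair:
  "expected_payoff2 G (pair_pmf \<sigma> \<tau>) = (\<Sum>t\<in>strats2 G. pmf \<tau> t * reply_payoff2 G (pmf \<sigma>) t)"
  unfolding expected_payoff2_def profiles_def reply_payoff2_def
  by (subst sum.cartesian_product', subst sum.swap) (simp add: pmf_pair sum_distrib_left mult_ac)

lemma simplex_average_le:
  fixes v :: "'i \<Rightarrow> real"
  assumes "finite S" "y \<in> simplex_on S" "\<And>s. s \<in> S \<Longrightarrow> v s \<le> m"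
  shows "(\<Sum>s\<in>S. y s * v s) \<le> m"
proof -
  have "(\<Sum>s\<in>S. y s * v s) \<le> (\<Sum>s\<in>S. y s * m)"
    using assms by (intro sum_mono mult_left_mono) (auto simp: simplex_on_def)
  also have "\<dots> = m" using assms by (simp add: simplex_on_def flip: sum_distrib_right)
  finally show ?thesis .
qed

lemma sum_return_pmf: "finite S \<Longrightarrow> s \<in> S \<Longrightarrow> (\<Sum>i\<in>S. pmf (return_pmf s) i * v i) = (v s :: real)"
  by (simp add: indicator_def if_distrib[of "\<lambda>c. c * _"] sum.If_cases cong: if_cong)

text \<open>Pure deviations bound every \<open>v s\<close> by the average, and the weighted
  shortfalls add up to 0, so they vanish on the support. Conversely \<open>v\<close> is constant on
  the support and equal there to its maximum over \<open>S\<close>.\<close>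

lemma mixed_best_reply_iff:
  fixes v :: "'i \<Rightarrow> real"
  assumes "finite S" "set_pmf \<sigma> \<subseteq> S"
  shows "(\<forall>\<sigma>'. set_pmf \<sigma>' \<subseteq> S \<longrightarrow> (\<Sum>s\<in>S. pmf \<sigma>' s * v s) \<le> (\<Sum>s\<in>S. pmf \<sigma> s * v s))
    \<longleftrightarrow> (\<forall>s\<in>set_pmf \<sigma>. \<forall>s'\<in>S. v s' \<le> v s)" (is "?L \<longleftrightarrow> ?R")
proof
  assume L: ?L
  let ?m = "\<Sum>s\<in>S. pmf \<sigma> s * v s"
  have le: "v s \<le> ?m" if "s \<in> S" for s
    using L[rule_format, of "return_pmf s"] that sum_return_pmf[OF assms(1) that, of v] by simp
  have "sum (pmf \<sigma>) S = 1" using pmf_in_simplex_on[OF assms] by (simp add: simplex_on_def)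
  then have "(\<Sum>s\<in>S. pmf \<sigma> s * (?m - v s)) = 0"
    by (simp add: algebra_simps sum_subtractf flip: sum_distrib_left sum_distrib_right)
  then have "\<forall>s\<in>S. pmf \<sigma> s * (?m - v s) = 0"
    using le assms(1) by (subst (asm) sum_nonneg_eq_0_iff) auto
  then have "v s = ?m" if "s \<in> set_pmf \<sigma>" for s
    using that assms(2) by (fastforce simp: set_pmf_iff)
  then show ?R using le by metis
next
  assume R: ?R
  obtain s0 where s0: "s0 \<in> set_pmf \<sigma>" using set_pmf_not_empty[of \<sigma>] by blast
  have "v s = v s0" if "s \<in> set_pmf \<sigma>" for s
    using R s0 assms(2) that by (meson antisym subsetD)
  then have "(\<Sum>s\<in>S. pmf \<sigma> s * v s) = (\<Sum>s\<in>S. pmf \<sigma> s * v s0)"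
    by (intro sum.cong) (auto simp: set_pmf_iff)
  also have "\<dots> = v s0"
    using pmf_in_simplex_on[OF assms] by (simp add: simplex_on_def flip: sum_distrib_right)
  finally show ?L
    using R s0 by (auto intro!: simplex_average_le pmf_in_simplex_on assms(1))
qed

lemma nash_equilibrium_iff:
  assumes "bimatrix_game G"
  shows "nash_equilibrium G \<sigma> \<tau> \<longleftrightarrow> set_pmf \<sigma> \<subseteq> strats1 G \<and> set_pmf \<tau> \<subseteq> strats2 G \<and>
    (\<forall>s\<in>set_pmf \<sigma>. \<forall>s'\<in>strats1 G. reply_payoff1 G (pmf \<tau>) s' \<le> reply_payoff1 G (pmf \<tau>) s) \<and>
    (\<forall>t\<in>set_pmf \<tau>. \<forall>t'\<in>strats2 G. reply_payoff2 G (pmf \<sigma>) t' \<le> reply_payoff2 G (pmf \<sigma>) t)"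
  using assms mixed_best_reply_iff[of "strats1 G" \<sigma> "reply_payoff1 G (pmf \<tau>)"]
    mixed_best_reply_iff[of "strats2 G" \<tau> "reply_payoff2 G (pmf \<sigma>)"]
  unfolding nash_equilibrium_def expected_payoff1_pair expected_payoff2_pair bimatrix_game_def
  by auto

text \<open>Existence guarantees that the union of rectangles has a nonempty member. The game to be
  built needs one, since its safe strategy lies in a rectangle block.\<close>

theorem nash_existence:
  assumes "bimatrix_game G"
  obtains \<sigma> \<tau> where "nash_equilibrium G \<sigma> \<tau>"
proof -
  define A where "A = strats1 G"
  define B where "B = strats2 G"
  have AB: "finite A" "A \<noteq> {}" "finite B" "B \<noteq> {}"
    using assms by (auto simp: bimatrix_game_def A_def B_def)
  \<comment> \<open>The cube carries both mixed strategies on the index set \<open>A <+> B\<close>;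
    each half is first retracted to its simplex and then improved by Nash's map.\<close>
  define ra where "ra x = simplex_retract A (\<lambda>s. x (Inl s))" for x :: "'a + 'b \<Rightarrow> real"
  define rb where "rb x = simplex_retract B (\<lambda>t. x (Inr t))" for x :: "'a + 'b \<Rightarrow> real"
  define fa where "fa x = nash_map A (ra x) (reply_payoff1 G (rb x))" for x
  define fb where "fb x = nash_map B (rb x) (reply_payoff2 G (ra x))" for x
  define f where "f x = case_sum (fa x) (fb x)" for x
  have in_simplex: "ra x \<in> simplex_on A" "rb x \<in> simplex_on B" "fa x \<in> simplex_on A" "fb x \<in> simplex_on B"
    if "\<And>j. j \<in> A <+> B \<Longrightarrow> x j \<in> {0..1}" for x
  proof -
    show r: "ra x \<in> simplex_on A" "rb x \<in> simplex_on B"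
      using that AB by (auto simp: ra_def rb_def intro!: simplex_retract_in)
    show "fa x \<in> simplex_on A" "fb x \<in> simplex_on B"
      using r by (auto simp: fa_def fb_def intro!: nash_map_in)
  qed
  have le1: "y s \<in> {0..1}" if "y \<in> simplex_on S" "finite S" "s \<in> S" for y s and S :: "'i set"
    using that member_le_sum[of s S y] by (auto simp: simplex_on_def)
  obtain x where x: "\<And>i. i \<in> A <+> B \<Longrightarrow> x i \<in> {0..1}" "\<And>i. i \<in> A <+> B \<Longrightarrow> f x i = x i"
  proof (rule brouwer_cube_finite[of "A <+> B" f])
    show "finite (A <+> B)" using AB by simp
  next
    fix x i assume "\<And>j. j \<in> A <+> B \<Longrightarrow> x j \<in> {0..1::real}" and "i \<in> A <+> B"
    then show "f x i \<in> {0..1}"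
      using le1[OF in_simplex(3)[of x] AB(1)] le1[OF in_simplex(4)[of x] AB(3)] by (auto simp: f_def)
  next
    fix X :: "nat \<Rightarrow> 'a + 'b \<Rightarrow> real" and x i
    assume lim: "\<And>j. j \<in> A <+> B \<Longrightarrow> (\<lambda>k. X k j) \<longlonglongrightarrow> x j" and i: "i \<in> A <+> B"
    have ra: "(\<lambda>k. ra (X k) s) \<longlonglongrightarrow> ra x s" if "s \<in> A" for s
      unfolding ra_def using that by (intro tendsto_simplex_retract) (auto intro: lim)
    have rb: "(\<lambda>k. rb (X k) s) \<longlonglongrightarrow> rb x s" if "s \<in> B" for s
      unfolding rb_def using that by (intro tendsto_simplex_retract) (auto intro: lim)
    have "(\<lambda>k. fa (X k) s) \<longlonglongrightarrow> fa x s" if "s \<in> A" for s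
      unfolding fa_def using that ra rb
      by (intro tendsto_nash_map) (auto simp: reply_payoff1_def B_def intro!: tendsto_intros)
    moreover have "(\<lambda>k. fb (X k) s) \<longlonglongrightarrow> fb x s" if "s \<in> B" for s
      unfolding fb_def using that ra rb
      by (intro tendsto_nash_map) (auto simp: reply_payoff2_def A_def intro!: tendsto_intros)
    ultimately show "(\<lambda>k. f (X k) i) \<longlonglongrightarrow> f x i" using i by (auto simp: f_def)
  qed (rule that)
  define xa where "xa s = x (Inl s)" for s
  define xb where "xb t = x (Inr t)" for t
  have eq: "\<And>s. s \<in> A \<Longrightarrow> fa x s = xa s" "\<And>t. t \<in> B \<Longrightarrow> fb x t = xb t"
    using x(2)[of "Inl _"] x(2)[of "Inr _"] by (auto simp: f_def xa_def xb_def)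
  \<comment> \<open>A fixed point equals its own image, whose halves lie in the simplices. Hence the
    retractions act on it as the identity, and it is a fixed point of Nash's map itself.\<close>
  have ab: "xa \<in> simplex_on A" "xb \<in> simplex_on B"
    using in_simplex(3,4)[of x, OF x(1)] eq by (simp_all add: simplex_on_def)
  have r: "ra x = xa" "rb x = xb"
    using simplex_retract_id[OF ab(1)] simplex_retract_id[OF ab(2)]
    unfolding ra_def rb_def xa_def[symmetric] xb_def[symmetric] by (auto intro: ext)
  obtain \<sigma> where \<sigma>: "set_pmf \<sigma> \<subseteq> A" "\<And>s. s \<in> A \<Longrightarrow> pmf \<sigma> s = xa s"
    using pmf_of_simplex_on[OF AB(1) ab(1)] by metis
  obtain \<tau> where \<tau>: "set_pmf \<tau> \<subseteq> B" "\<And>t. t \<in> B \<Longrightarrow> pmf \<tau> t = xb t"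
    using pmf_of_simplex_on[OF AB(3) ab(2)] by metis
  have v: "reply_payoff1 G (pmf \<tau>) = reply_payoff1 G xb" "reply_payoff2 G (pmf \<sigma>) = reply_payoff2 G xa"
    using \<sigma> \<tau> by (auto simp: reply_payoff1_def reply_payoff2_def A_def B_def)
  have "reply_payoff1 G xb s \<le> (\<Sum>i\<in>A. xa i * reply_payoff1 G xb i)" if "s \<in> A" for s
    using nash_map_fixpoint[OF AB(1) ab(1) _ that] eq AB(4) by (auto simp: fa_def r)
  moreover have "reply_payoff2 G xa t \<le> (\<Sum>i\<in>B. xb i * reply_payoff2 G xa i)" if "t \<in> B" for t
    using nash_map_fixpoint[OF AB(3) ab(2) _ that] eq AB(2) by (auto simp: fb_def r)
  ultimately have "nash_equilibrium G \<sigma> \<tau>"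
    using \<sigma> \<tau> AB unfolding nash_equilibrium_def expected_payoff1_pair expected_payoff2_pair v
    by (auto simp: A_def[symmetric] B_def[symmetric] intro!: simplex_average_le pmf_in_simplex_on)
  then show ?thesis by (rule that)
qed

section \<open>Nash payoffs as a union of rectangles\<close>

text \<open>The set is the image under a linear functional of a compact convex subset of the
  simplex. An infeasible system of constraints gives the empty interval, with
  \<open>b < a\<close>.\<close>

lemma constrained_average_interval:
  fixes v :: "'i \<Rightarrow> real"
  assumes "finite A"
  shows "\<exists>a b. {\<Sum>s\<in>A. pmf \<sigma> s * v s | \<sigma>. set_pmf \<sigma> \<subseteq> A \<and> (\<forall>c\<in>C. 0 \<le> (\<Sum>s\<in>A. pmf \<sigma> s * c s))} = {a..b}"
    (is "\<exists>a b. ?V = _")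
proof -
  define K where "K = {x \<in> simplex_on A. \<forall>c\<in>C. 0 \<le> (\<Sum>s\<in>A. x s * c s)}"
  define avg where "avg x = (\<Sum>s\<in>A. x s * v s)" for x
  have V: "?V = avg ` K"
  proof (intro equalityI subsetI)
    fix r assume "r \<in> ?V"
    then show "r \<in> avg ` K" using pmf_in_simplex_on[OF assms] by (auto simp: K_def avg_def)
  next
    fix r assume "r \<in> avg ` K"
    then obtain x where x: "x \<in> K" "r = avg x" by blast
    then obtain p where p: "set_pmf p \<subseteq> A" "\<And>s. s \<in> A \<Longrightarrow> pmf p s = x s"
      using pmf_of_simplex_on[OF assms, of x] by (auto simp: K_def)
    have "(\<Sum>s\<in>A. pmf p s * w s) = (\<Sum>s\<in>A. x s * w s)" for w :: "'i \<Rightarrow> real"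
      using p(2) by simp
    then show "r \<in> ?V" using x p(1) by (auto simp: K_def avg_def intro!: exI[of _ p])
  qed
  have "convex (avg ` K)"
  proof (rule convexI)
    fix p q u w :: real
    assume "p \<in> avg ` K" "q \<in> avg ` K" and uw: "0 \<le> u" "0 \<le> w" "u + w = 1"
    then obtain x y where xy: "x \<in> K" "p = avg x" "y \<in> K" "q = avg y" by blast
    have lin: "(\<Sum>s\<in>A. (u * x s + w * y s) * c s) = u * (\<Sum>s\<in>A. x s * c s) + w * (\<Sum>s\<in>A. y s * c s)" for c
      by (simp add: algebra_simps sum.distrib sum_distrib_left)
    have "sum (\<lambda>s. u * x s + w * y s) A = 1" "\<forall>s\<in>A. 0 \<le> u * x s + w * y s"
      using xy uw by (simp_all add: K_def simplex_on_def sum.distrib flip: sum_distrib_left)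
    moreover have "\<forall>c\<in>C. 0 \<le> (\<Sum>s\<in>A. (u * x s + w * y s) * c s)"
      unfolding lin using xy uw by (simp add: K_def)
    ultimately have "(\<lambda>s. u * x s + w * y s) \<in> K" by (simp add: K_def simplex_on_def)
    moreover have "avg (\<lambda>s. u * x s + w * y s) = u *\<^sub>R p + w *\<^sub>R q"
      using lin xy by (simp add: avg_def)
    ultimately show "u *\<^sub>R p + w *\<^sub>R q \<in> avg ` K" by (metis (no_types, lifting) image_eqI)
  qed
  moreover have "compact (avg ` K)"
    unfolding compact_def
  proof (intro allI impI)
    fix f :: "nat \<Rightarrow> real" assume "\<forall>n. f n \<in> avg ` K"
    then have "\<forall>n. \<exists>x. x \<in> K \<and> f n = avg x" by blast
    from choice[OF this] obtain X where X: "\<And>n. X n \<in> K" "\<And>n. f n = avg (X n)" by blast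
    have nn: "0 \<le> X n i" if "i \<in> A" for n i using X(1)[of n] that by (simp add: K_def simplex_on_def)
    have one: "sum (X n) A = 1" for n using X(1)[of n] by (simp add: K_def simplex_on_def)
    have X01: "X n i \<in> {0..1}" if "i \<in> A" for n i
      using member_le_sum[of i A "X n"] nn one assms that by auto
    obtain l r where r: "strict_mono (r :: nat \<Rightarrow> nat)" and l: "\<And>i. i \<in> A \<Longrightarrow> (\<lambda>k. X (r k) i) \<longlonglongrightarrow> l i"
    proof (rule pointwise_convergent_subsequence[of A X])
      show "finite A" by fact
      show "\<And>k i. i \<in> A \<Longrightarrow> X k i \<in> {0..1}" by (rule X01)
    qed blast
    \<comment> \<open>Total mass, constraints and average are all sums of this shape, so one limit
      serves for the three.\<close>
    have lim: "(\<lambda>k. \<Sum>s\<in>A. X (r k) s * c s) \<longlonglongrightarrow> (\<Sum>s\<in>A. l s * c s)" for c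
      using l by (intro tendsto_sum tendsto_mult tendsto_const)
    have "0 \<le> l i" if "i \<in> A" for i
      by (rule LIMSEQ_le_const[OF l[OF that]]) (use nn that in blast)
    moreover have "sum l A = 1"
      using LIMSEQ_unique[OF lim[of "\<lambda>_. 1"]] one by simp
    moreover have "0 \<le> (\<Sum>s\<in>A. l s * c s)" if "c \<in> C" for c
      by (rule LIMSEQ_le_const[OF lim]) (use X(1) that in \<open>auto simp: K_def\<close>)
    ultimately have "l \<in> K" by (simp add: K_def simplex_on_def)
    moreover have "(f \<circ> r) \<longlonglongrightarrow> avg l"
      using lim[of v] X(2) by (simp add: o_def avg_def)
    ultimately show "\<exists>l\<in>avg ` K. \<exists>r. strict_mono r \<and> (f \<circ> r) \<longlonglongrightarrow> l" using r by blast
  qed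
  ultimately show ?thesis
    unfolding V by (simp add: convex_connected flip: connected_compact_interval_1)
qed

section \<open>Equilibria with prescribed supports and best replies\<close>

lemma reply_payoff1_restrict:
  assumes "bimatrix_game G" "set_pmf \<tau> \<subseteq> B" "B \<subseteq> strats2 G"
  shows "reply_payoff1 G (pmf \<tau>) s = (\<Sum>t\<in>B. pmf \<tau> t * payoff1 G (s, t))"
  unfolding reply_payoff1_def using assms
  by (intro sum.mono_neutral_right) (auto simp: bimatrix_game_def set_pmf_iff)

lemma reply_payoff2_restrict:
  assumes "bimatrix_game G" "set_pmf \<sigma> \<subseteq> A" "A \<subseteq> strats1 G"
  shows "reply_payoff2 G (pmf \<sigma>) t = (\<Sum>s\<in>A. pmf \<sigma> s * payoff2 G (s, t))"
  unfolding reply_payoff2_def using assms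
  by (intro sum.mono_neutral_right) (auto simp: bimatrix_game_def set_pmf_iff)

lemma pmf_average_const:
  fixes v :: "'i \<Rightarrow> real"
  assumes "finite S" "set_pmf \<sigma> \<subseteq> S" "\<And>s. s \<in> set_pmf \<sigma> \<Longrightarrow> v s = m"
  shows "(\<Sum>s\<in>S. pmf \<sigma> s * v s) = m"
proof -
  have "(\<Sum>s\<in>S. pmf \<sigma> s * v s) = (\<Sum>s\<in>S. pmf \<sigma> s * m)"
    using assms(3) by (intro sum.cong) (auto simp: set_pmf_iff)
  also have "\<dots> = m"
    using sum_pmf_eq_1[OF assms(1,2)] by (simp flip: sum_distrib_right)
  finally show ?thesis .
qed

text \<open>A mixed strategy of player 1 determines which strategies of player 2 are best replies.
  This is why the condition on \<open>B\<close> sits here: it restricts \<sigma> alone.\<close>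

definition replies_in1 :: "('a, 'b) bimatrix \<Rightarrow> 'a set \<Rightarrow> 'b set \<Rightarrow> 'a pmf set" where
  "replies_in1 G A B = {\<sigma>. set_pmf \<sigma> \<subseteq> A \<and>
     (\<forall>t\<in>B. \<forall>t'\<in>strats2 G. reply_payoff2 G (pmf \<sigma>) t' \<le> reply_payoff2 G (pmf \<sigma>) t)}"

definition replies_in2 :: "('a, 'b) bimatrix \<Rightarrow> 'a set \<Rightarrow> 'b set \<Rightarrow> 'b pmf set" where
  "replies_in2 G A B = {\<tau>. set_pmf \<tau> \<subseteq> B \<and>
     (\<forall>s\<in>A. \<forall>s'\<in>strats1 G. reply_payoff1 G (pmf \<tau>) s' \<le> reply_payoff1 G (pmf \<tau>) s)}"

text \<open>The two supports serve as \<open>A\<close> and \<open>B\<close>. Conversely, each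
  support is contained in a set of best replies.\<close>

lemma nash_equilibrium_iff_replies_in:
  assumes "bimatrix_game G"
  shows "nash_equilibrium G \<sigma> \<tau> \<longleftrightarrow>
    (\<exists>A B. A \<noteq> {} \<and> A \<subseteq> strats1 G \<and> B \<noteq> {} \<and> B \<subseteq> strats2 G \<and>
       \<sigma> \<in> replies_in1 G A B \<and> \<tau> \<in> replies_in2 G A B)" (is "?L \<longleftrightarrow> ?R")
proof
  assume ?L
  then show ?R
    using assms set_pmf_not_empty[of \<sigma>] set_pmf_not_empty[of \<tau>]
    by (intro exI[of _ "set_pmf \<sigma>"] exI[of _ "set_pmf \<tau>"])
      (auto simp: nash_equilibrium_iff replies_in1_def replies_in2_def)
next
  assume ?R
  then show ?L using assms by (auto simp: nash_equilibrium_iff replies_in1_def replies_in2_def subset_iff)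
qed

text \<open>All strategies in \<open>A\<close> are best replies to \<tau> and so earn the same; how
  \<sigma> mixes them is irrelevant to player 1. The same holds for player 2.\<close>

lemma replies_in_payoffs:
  assumes "bimatrix_game G" "s0 \<in> A" "A \<subseteq> strats1 G" "t0 \<in> B" "B \<subseteq> strats2 G"
    and "\<sigma> \<in> replies_in1 G A B" "\<tau> \<in> replies_in2 G A B"
  shows "expected_payoff1 G (pair_pmf \<sigma> \<tau>) = reply_payoff1 G (pmf \<tau>) s0"
    and "expected_payoff2 G (pair_pmf \<sigma> \<tau>) = reply_payoff2 G (pmf \<sigma>) t0"
proof -
  have supp: "set_pmf \<sigma> \<subseteq> A" "set_pmf \<tau> \<subseteq> B" using assms by (auto simp: replies_in1_def replies_in2_def)
  have fin: "finite (strats1 G)" "finite (strats2 G)" using assms(1) by (auto simp: bimatrix_game_def)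
  have "reply_payoff1 G (pmf \<tau>) s = reply_payoff1 G (pmf \<tau>) s0" if "s \<in> A" for s
    using assms that by (intro antisym) (auto simp: replies_in2_def)
  with supp(1) show "expected_payoff1 G (pair_pmf \<sigma> \<tau>) = reply_payoff1 G (pmf \<tau>) s0"
    unfolding expected_payoff1_pair
    by (intro pmf_average_const[OF fin(1) subset_trans[OF supp(1) assms(3)]]) blast
  have "reply_payoff2 G (pmf \<sigma>) t = reply_payoff2 G (pmf \<sigma>) t0" if "t \<in> B" for t
    using assms that by (intro antisym) (auto simp: replies_in1_def)
  with supp(2) show "expected_payoff2 G (pair_pmf \<sigma> \<tau>) = reply_payoff2 G (pmf \<sigma>) t0"
    unfolding expected_payoff2_pair
    by (intro pmf_average_const[OF fin(2) subset_trans[OF supp(2) assms(5)]]) blast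
qed

lemma replies_in1_interval:
  assumes "bimatrix_game G" "A \<subseteq> strats1 G"
  shows "\<exists>a b. (\<lambda>\<sigma>. reply_payoff2 G (pmf \<sigma>) t0) ` replies_in1 G A B = {a..b}"
proof -
  \<comment> \<open>Each comparison of a member of \<open>B\<close> with another strategy of player
    2 is one linear constraint on \<sigma>.\<close>
  define C where "C = {\<lambda>s. payoff2 G (s, t) - payoff2 G (s, t') | t t'. t \<in> B \<and> t' \<in> strats2 G}"
  have "finite A" using assms finite_subset by (auto simp: bimatrix_game_def)
  have "\<sigma> \<in> replies_in1 G A B \<longleftrightarrow> set_pmf \<sigma> \<subseteq> A \<and> (\<forall>c\<in>C. 0 \<le> (\<Sum>s\<in>A. pmf \<sigma> s * c s))" for \<sigma>
  proof (cases "set_pmf \<sigma> \<subseteq> A")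
    case True
    have "(\<forall>c\<in>C. 0 \<le> (\<Sum>s\<in>A. pmf \<sigma> s * c s)) \<longleftrightarrow> (\<forall>t\<in>B. \<forall>t'\<in>strats2 G.
        0 \<le> (\<Sum>s\<in>A. pmf \<sigma> s * (payoff2 G (s, t) - payoff2 G (s, t'))))"
      unfolding C_def by auto
    then show ?thesis
      using reply_payoff2_restrict[OF assms(1) True assms(2)] True
      by (simp add: replies_in1_def right_diff_distrib sum_subtractf)
  qed (simp add: replies_in1_def)
  then have eq: "(\<lambda>\<sigma>. reply_payoff2 G (pmf \<sigma>) t0) ` replies_in1 G A B =
      {\<Sum>s\<in>A. pmf \<sigma> s * payoff2 G (s, t0) | \<sigma>. set_pmf \<sigma> \<subseteq> A \<and> (\<forall>c\<in>C. 0 \<le> (\<Sum>s\<in>A. pmf \<sigma> s * c s))}"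
    using reply_payoff2_restrict[OF assms(1) _ assms(2)] by (auto simp: image_iff)
  show ?thesis unfolding eq by (rule constrained_average_interval[OF \<open>finite A\<close>])
qed

lemma replies_in2_interval:
  assumes "bimatrix_game G" "B \<subseteq> strats2 G"
  shows "\<exists>a b. (\<lambda>\<tau>. reply_payoff1 G (pmf \<tau>) s0) ` replies_in2 G A B = {a..b}"
proof -
  define C where "C = {\<lambda>t. payoff1 G (s, t) - payoff1 G (s', t) | s s'. s \<in> A \<and> s' \<in> strats1 G}"
  have "finite B" using assms finite_subset by (auto simp: bimatrix_game_def)
  have "\<tau> \<in> replies_in2 G A B \<longleftrightarrow> set_pmf \<tau> \<subseteq> B \<and> (\<forall>c\<in>C. 0 \<le> (\<Sum>t\<in>B. pmf \<tau> t * c t))" for \<tau>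
  proof (cases "set_pmf \<tau> \<subseteq> B")
    case True
    have "(\<forall>c\<in>C. 0 \<le> (\<Sum>t\<in>B. pmf \<tau> t * c t)) \<longleftrightarrow> (\<forall>s\<in>A. \<forall>s'\<in>strats1 G.
        0 \<le> (\<Sum>t\<in>B. pmf \<tau> t * (payoff1 G (s, t) - payoff1 G (s', t))))"
      unfolding C_def by auto
    then show ?thesis
      using reply_payoff1_restrict[OF assms(1) True assms(2)] True
      by (simp add: replies_in2_def right_diff_distrib sum_subtractf)
  qed (simp add: replies_in2_def)
  then have eq: "(\<lambda>\<tau>. reply_payoff1 G (pmf \<tau>) s0) ` replies_in2 G A B =
      {\<Sum>t\<in>B. pmf \<tau> t * payoff1 G (s0, t) | \<tau>. set_pmf \<tau> \<subseteq> B \<and> (\<forall>c\<in>C. 0 \<le> (\<Sum>t\<in>B. pmf \<tau> t * c t))}"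
    using reply_payoff1_restrict[OF assms(1) _ assms(2)] by (auto simp: image_iff)
  show ?thesis unfolding eq by (rule constrained_average_interval[OF \<open>finite B\<close>])
qed

theorem NEP_union_of_rectangles:
  assumes "bimatrix_game G"
  obtains K :: nat and a b c d where "K > 0" "\<And>k. k < K \<Longrightarrow> a k \<le> b k \<and> c k \<le> d k"
    and "NEP G = (\<Union>k<K. {a k..b k} \<times> {c k..d k})"
proof -
  define J where "J = (Pow (strats1 G) - {{}}) \<times> (Pow (strats2 G) - {{}})"
  have "finite J" using assms by (auto simp: J_def bimatrix_game_def)
  define R where "R j = (\<lambda>(\<sigma>, \<tau>). (expected_payoff1 G (pair_pmf \<sigma> \<tau>), expected_payoff2 G (pair_pmf \<sigma> \<tau>))) `
    (replies_in1 G (fst j) (snd j) \<times> replies_in2 G (fst j) (snd j))" for j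
  have NEP: "NEP G = (\<Union>j\<in>J. R j)"
  proof (intro equalityI subsetI)
    fix z assume "z \<in> NEP G"
    then obtain \<sigma> \<tau> where z: "z = (expected_payoff1 G (pair_pmf \<sigma> \<tau>), expected_payoff2 G (pair_pmf \<sigma> \<tau>))"
      and "nash_equilibrium G \<sigma> \<tau>"
      by (auto simp: NEP_def)
    then obtain A B where AB: "(A, B) \<in> J" "\<sigma> \<in> replies_in1 G A B" "\<tau> \<in> replies_in2 G A B"
      unfolding nash_equilibrium_iff_replies_in[OF assms] J_def by blast
    have "z \<in> R (A, B)" unfolding R_def fst_conv snd_conv using z AB by (intro image_eqI[of _ _ "(\<sigma>, \<tau>)"]) auto
    then show "z \<in> (\<Union>j\<in>J. R j)" using AB(1) by blast
  next
    fix z assume "z \<in> (\<Union>j\<in>J. R j)"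
    then obtain A B where "(A, B) \<in> J" "z \<in> R (A, B)" by (metis UN_E prod.collapse)
    then obtain \<sigma> \<tau> where "z = (expected_payoff1 G (pair_pmf \<sigma> \<tau>), expected_payoff2 G (pair_pmf \<sigma> \<tau>))"
      "\<sigma> \<in> replies_in1 G A B" "\<tau> \<in> replies_in2 G A B"
      unfolding R_def by auto
    moreover from this \<open>(A, B) \<in> J\<close> have "nash_equilibrium G \<sigma> \<tau>"
      unfolding nash_equilibrium_iff_replies_in[OF assms] J_def by blast
    ultimately show "z \<in> NEP G" unfolding NEP_def by blast
  qed
  have rect: "\<exists>a b c d. R j = {a..b} \<times> {c..d}" if "j \<in> J" for j
  proof -
    obtain A B where j: "j = (A, B)" "A \<noteq> {}" "A \<subseteq> strats1 G" "B \<noteq> {}" "B \<subseteq> strats2 G"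
      using \<open>j \<in> J\<close> by (auto simp: J_def)
    then obtain s0 t0 where st: "s0 \<in> A" "t0 \<in> B" by blast
    \<comment> \<open>The first payoff depends only on \<tau> and the second only on \<sigma>, so
      the image of a product of strategy sets is a product of intervals, with the factors
      exchanged.\<close>
    have "R j = (\<lambda>(\<sigma>, \<tau>). (reply_payoff1 G (pmf \<tau>) s0, reply_payoff2 G (pmf \<sigma>) t0)) `
        (replies_in1 G A B \<times> replies_in2 G A B)"
      unfolding R_def j(1) fst_conv snd_conv
      using replies_in_payoffs[OF assms st(1) j(3) st(2) j(5)] by (intro image_cong) auto
    also have "\<dots> = (\<lambda>\<tau>. reply_payoff1 G (pmf \<tau>) s0) ` replies_in2 G A B \<times>
        (\<lambda>\<sigma>. reply_payoff2 G (pmf \<sigma>) t0) ` replies_in1 G A B"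
      by force
    finally show ?thesis
      using replies_in1_interval[OF assms j(3), of t0 B] replies_in2_interval[OF assms j(5), of s0 A]
      by metis
  qed
  then obtain a b c d where R: "\<And>j. j \<in> J \<Longrightarrow> R j = {a j..b j} \<times> {c j..d j}" by metis
  \<comment> \<open>Empty pieces are dropped: a block of the new game always contributes an
    equilibrium, so it can encode nonempty rectangles only.\<close>
  define J' where "J' = {j \<in> J. R j \<noteq> {}}"
  have "finite J'" using \<open>finite J\<close> by (simp add: J'_def)
  then obtain h where h: "bij_betw h {0..<card J'} J'" using ex_bij_betw_nat_finite by blast
  have hJ: "h k \<in> J" "R (h k) \<noteq> {}" if "k < card J'" for k
  proof -
    have "h k \<in> J'" using h that by (auto simp: bij_betw_def)
    then show "h k \<in> J" "R (h k) \<noteq> {}" by (simp_all add: J'_def)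
  qed
  obtain \<sigma> \<tau> where "nash_equilibrium G \<sigma> \<tau>" by (rule nash_existence[OF assms])
  then have "NEP G \<noteq> {}" unfolding NEP_def by blast
  have NEP': "NEP G = (\<Union>k<card J'. R (h k))"
  proof -
    have "NEP G = (\<Union>j\<in>J'. R j)" unfolding NEP J'_def by blast
    also have "J' = h ` {0..<card J'}" using h by (simp add: bij_betw_def)
    finally show ?thesis by (simp add: atLeast0LessThan)
  qed
  show thesis
  proof (rule that)
    show "card J' > 0" using \<open>NEP G \<noteq> {}\<close> NEP' by (intro gr0I) simp
    show "NEP G = (\<Union>k<card J'. {a (h k)..b (h k)} \<times> {c (h k)..d (h k)})"
      unfolding NEP' using R hJ(1) by (intro SUP_cong refl) simp
    fix k assume "k < card J'"
    then have "{a (h k)..b (h k)} \<times> {c (h k)..d (h k)} \<noteq> {}" using hJ R by metis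
    then show "a (h k) \<le> b (h k) \<and> c (h k) \<le> d (h k)" by auto
  qed
qed

section \<open>Games built from blocks\<close>

text \<open>Incentive constraints and payoffs are linear in the distribution. Hence a polytope lies
  in the set as soon as its generators do.\<close>

lemma convex_CEP:
  assumes "bimatrix_game G"
  shows "convex (CEP G)"
proof (rule convexI)
  fix p q u w
  assume "p \<in> CEP G" "q \<in> CEP G" and uw: "0 \<le> u" "0 \<le> w" "u + w = (1::real)"
  then obtain \<mu> \<nu> where ce: "correlated_equilibrium G \<mu>" "correlated_equilibrium G \<nu>"
    and pq: "p = (expected_payoff1 G \<mu>, expected_payoff2 G \<mu>)" "q = (expected_payoff1 G \<nu>, expected_payoff2 G \<nu>)"
    unfolding CEP_def by blast
  have fin: "finite (profiles G)" using assms by (simp add: bimatrix_game_def profiles_def)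
  have supp: "set_pmf \<mu> \<subseteq> profiles G" "set_pmf \<nu> \<subseteq> profiles G"
    using ce by (simp_all add: correlated_equilibrium_def)
  define x where "x z = u * pmf \<mu> z + w * pmf \<nu> z" for z
  have "sum x (profiles G) = u * sum (pmf \<mu>) (profiles G) + w * sum (pmf \<nu>) (profiles G)"
    by (simp add: x_def sum.distrib sum_distrib_left)
  then have "x \<in> simplex_on (profiles G)"
    using uw sum_pmf_eq_1[OF fin supp(1)] sum_pmf_eq_1[OF fin supp(2)] by (simp add: simplex_on_def x_def)
  then obtain \<rho> where \<rho>: "set_pmf \<rho> \<subseteq> profiles G" "\<And>z. z \<in> profiles G \<Longrightarrow> pmf \<rho> z = x z"
    using pmf_of_simplex_on[OF fin] by blast
  have lin: "(\<Sum>i\<in>A. pmf \<rho> (z i) * f i) = u * (\<Sum>i\<in>A. pmf \<mu> (z i) * f i) + w * (\<Sum>i\<in>A. pmf \<nu> (z i) * f i)"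
    if "\<And>i. i \<in> A \<Longrightarrow> z i \<in> profiles G" for A :: "'i set" and z f
  proof -
    have "(\<Sum>i\<in>A. pmf \<rho> (z i) * f i) = (\<Sum>i\<in>A. u * (pmf \<mu> (z i) * f i) + w * (pmf \<nu> (z i) * f i))"
      using \<rho>(2)[OF that] by (intro sum.cong) (auto simp: x_def algebra_simps)
    then show ?thesis by (simp add: sum.distrib sum_distrib_left)
  qed
  have "correlated_equilibrium G \<rho>"
    unfolding correlated_equilibrium_def
  proof (intro conjI ballI)
    show "set_pmf \<rho> \<subseteq> profiles G" by fact
    fix s s' assume s: "s \<in> strats1 G" "s' \<in> strats1 G"
    have "(\<Sum>t\<in>strats2 G. pmf \<rho> (s, t) * (payoff1 G (s, t) - payoff1 G (s', t)))
      = u * (\<Sum>t\<in>strats2 G. pmf \<mu> (s, t) * (payoff1 G (s, t) - payoff1 G (s', t)))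
      + w * (\<Sum>t\<in>strats2 G. pmf \<nu> (s, t) * (payoff1 G (s, t) - payoff1 G (s', t)))"
      using s by (intro lin) (simp add: profiles_def)
    then show "0 \<le> (\<Sum>t\<in>strats2 G. pmf \<rho> (s, t) * (payoff1 G (s, t) - payoff1 G (s', t)))"
      using ce uw s by (simp add: correlated_equilibrium_def)
  next
    fix t t' assume t: "t \<in> strats2 G" "t' \<in> strats2 G"
    have "(\<Sum>s\<in>strats1 G. pmf \<rho> (s, t) * (payoff2 G (s, t) - payoff2 G (s, t')))
      = u * (\<Sum>s\<in>strats1 G. pmf \<mu> (s, t) * (payoff2 G (s, t) - payoff2 G (s, t')))
      + w * (\<Sum>s\<in>strats1 G. pmf \<nu> (s, t) * (payoff2 G (s, t) - payoff2 G (s, t')))"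
      using t by (intro lin) (simp add: profiles_def)
    then show "0 \<le> (\<Sum>s\<in>strats1 G. pmf \<rho> (s, t) * (payoff2 G (s, t) - payoff2 G (s, t')))"
      using ce uw t by (simp add: correlated_equilibrium_def)
  qed
  moreover have "u *\<^sub>R p + w *\<^sub>R q = (expected_payoff1 G \<rho>, expected_payoff2 G \<rho>)"
    unfolding pq expected_payoff1_def expected_payoff2_def using lin[of "profiles G" "\<lambda>z. z"] by simp
  ultimately show "u *\<^sub>R p + w *\<^sub>R q \<in> CEP G" unfolding CEP_def by blast
qed

text \<open>For a product distribution the incentive sum factors into the probability of the
  recommendation and its advantage over the deviation. The first vanishes off the support, the
  second is nonnegative on it.\<close>

lemma nash_imp_correlated:
  assumes "bimatrix_game G" "nash_equilibrium G \<sigma> \<tau>"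
  shows "correlated_equilibrium G (pair_pmf \<sigma> \<tau>)"
  unfolding correlated_equilibrium_def
proof (intro conjI ballI)
  note ne = assms(2)[unfolded nash_equilibrium_iff[OF assms(1)]]
  show "set_pmf (pair_pmf \<sigma> \<tau>) \<subseteq> profiles G" using ne by (auto simp: profiles_def)
  fix s s' assume s: "s \<in> strats1 G" "s' \<in> strats1 G"
  have "(\<Sum>t\<in>strats2 G. pmf (pair_pmf \<sigma> \<tau>) (s, t) * (payoff1 G (s, t) - payoff1 G (s', t)))
    = pmf \<sigma> s * (reply_payoff1 G (pmf \<tau>) s - reply_payoff1 G (pmf \<tau>) s')"
    by (simp add: pmf_pair reply_payoff1_def sum_distrib_left right_diff_distrib sum_subtractf mult.assoc)
  also have "0 \<le> \<dots>" using ne s by (cases "s \<in> set_pmf \<sigma>") (auto simp: set_pmf_iff)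
  finally show "0 \<le> (\<Sum>t\<in>strats2 G. pmf (pair_pmf \<sigma> \<tau>) (s, t) * (payoff1 G (s, t) - payoff1 G (s', t)))" .
next
  note ne = assms(2)[unfolded nash_equilibrium_iff[OF assms(1)]]
  fix t t' assume t: "t \<in> strats2 G" "t' \<in> strats2 G"
  have "(\<Sum>s\<in>strats1 G. pmf (pair_pmf \<sigma> \<tau>) (s, t) * (payoff2 G (s, t) - payoff2 G (s, t')))
    = pmf \<tau> t * (reply_payoff2 G (pmf \<sigma>) t - reply_payoff2 G (pmf \<sigma>) t')"
    by (simp add: pmf_pair reply_payoff2_def sum_distrib_left right_diff_distrib sum_subtractf mult_ac)
  also have "0 \<le> \<dots>" using ne t by (cases "t \<in> set_pmf \<tau>") (auto simp: set_pmf_iff)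
  finally show "0 \<le> (\<Sum>s\<in>strats1 G. pmf (pair_pmf \<sigma> \<tau>) (s, t) * (payoff2 G (s, t) - payoff2 G (s, t')))" .
qed

text \<open>Strategy \<open>n\<close> has block \<open>n div 3\<close> and index \<open>n mod 3\<close>. The blocks below \<open>K\<close> encode rectangles,
  the others encode vertices. In \<open>bonus s t\<close> the player's own strategy comes first, for either player.\<close>

locale block_game =
  fixes K N :: nat and X Y :: "nat \<Rightarrow> real"
  assumes K: "0 < K" "K \<le> N"
begin

definition bonus :: "nat \<Rightarrow> nat \<Rightarrow> real" where
  "bonus s t =
    (if s div 3 \<noteq> t div 3 then (if s div 3 = 0 then 0 else -1)
     else if s div 3 < K then 0
     else if s mod 3 = (t + 1) mod 3 then 1 else -1)"

definition game :: "(nat, nat) bimatrix" where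
  "game = \<lparr>strats1 = {..<3 * N}, strats2 = {..<3 * N},
     payoff1 = (\<lambda>(s, t). X t + bonus s t), payoff2 = (\<lambda>(s, t). Y s + bonus t s)\<rparr>"

lemma game_simps [simp]:
  "strats1 game = {..<3 * N}" "strats2 game = {..<3 * N}"
  "payoff1 game (s, t) = X t + bonus s t" "payoff2 game (s, t) = Y s + bonus t s"
  "profiles game = {..<3 * N} \<times> {..<3 * N}"
  by (simp_all add: game_def profiles_def)

lemma bimatrix_game_game: "bimatrix_game game"
  using K by (auto simp: bimatrix_game_def lessThan_empty_iff)

text \<open>Strategy 0 is the safe strategy: block 0 is a rectangle block because
  \<open>0 < K\<close>, and its strategies lose nothing off the diagonal.\<close>

lemma bonus_0 [simp]: "bonus 0 t = 0"
  using K by (simp add: bonus_def)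

text \<open>Of two distinct blocks at most one is block 0, so the other player pays 1. In a vertex
  block two indices cannot both beat each other.\<close>

lemma bonus_sum_le: "bonus s t + bonus t s \<le> 0"
proof -
  have "\<not> (s mod 3 = (t + 1) mod 3 \<and> t mod 3 = (s + 1) mod 3)"
    by (simp add: mod_Suc)
  then show ?thesis by (auto simp: bonus_def)
qed

section \<open>Supports and payoffs of correlated equilibria\<close>

lemma bonus_sum_eq_0:
  assumes "bonus s t + bonus t s = 0"
  shows "s div 3 = t div 3" and "s div 3 < K \<or> s \<noteq> t"
  using assms by (auto simp: bonus_def split: if_splits)

lemma correlated_equilibriumD:
  assumes "correlated_equilibrium game \<mu>"
  shows "\<And>s t. (s, t) \<in> set_pmf \<mu> \<Longrightarrow> bonus s t + bonus t s = 0"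
    and "\<And>s. s < 3 * N \<Longrightarrow> (\<Sum>t<3 * N. pmf \<mu> (s, t) * bonus s t) = 0"
    and "\<And>t. t < 3 * N \<Longrightarrow> (\<Sum>s<3 * N. pmf \<mu> (s, t) * bonus t s) = 0"
proof -
  let ?S = "{..<3 * N}"
  have z: "0 \<in> ?S" using K by simp
  \<comment> \<open>\<open>f s\<close> and \<open>g t\<close> are the unnormalised expected bonuses
    after the recommendations \<open>s\<close> and \<open>t\<close>. Compared with the safe strategy
    the opponent's terms cancel, so the incentive constraints say that they are nonnegative.\<close>
  define f where "f s = (\<Sum>t\<in>?S. pmf \<mu> (s, t) * bonus s t)" for s
  define g where "g t = (\<Sum>s\<in>?S. pmf \<mu> (s, t) * bonus t s)" for t
  have f: "0 \<le> f s" if "s \<in> ?S" for s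
  proof -
    have "0 \<le> (\<Sum>t\<in>?S. pmf \<mu> (s, t) * (payoff1 game (s, t) - payoff1 game (0, t)))"
      using assms that z unfolding correlated_equilibrium_def game_simps(1,2) by blast
    then show ?thesis by (simp add: f_def)
  qed
  have g: "0 \<le> g t" if "t \<in> ?S" for t
  proof -
    have "0 \<le> (\<Sum>s\<in>?S. pmf \<mu> (s, t) * (payoff2 game (s, t) - payoff2 game (s, 0)))"
      using assms that z unfolding correlated_equilibrium_def game_simps(1,2) by blast
    then show ?thesis by (simp add: g_def)
  qed
  \<comment> \<open>\<open>e z\<close> is the joint loss at \<open>z\<close>, weighted by its
    probability. The totals of \<open>f\<close>, \<open>g\<close> and \<open>e\<close> are
    nonnegative and add up to 0, so every summand vanishes.\<close>
  define e where "e z = pmf \<mu> z * - (bonus (fst z) (snd z) + bonus (snd z) (fst z))" for z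
  have e: "0 \<le> e z" for z
    unfolding e_def by (intro mult_nonneg_nonneg) (use bonus_sum_le[of "fst z" "snd z"] in auto)
  have "sum f ?S + sum g ?S = - sum e (?S \<times> ?S)"
  proof -
    have "sum g ?S = (\<Sum>s\<in>?S. \<Sum>t\<in>?S. pmf \<mu> (s, t) * bonus t s)"
      unfolding g_def by (rule sum.swap)
    then show ?thesis
      unfolding f_def sum.cartesian_product'
      by (simp add: e_def algebra_simps sum.distrib sum_negf sum_subtractf)
  qed
  moreover have "0 \<le> sum f ?S" "0 \<le> sum g ?S" "0 \<le> sum e (?S \<times> ?S)"
    using f g e by (auto intro: sum_nonneg)
  ultimately have zero: "sum f ?S = 0" "sum g ?S = 0" "sum e (?S \<times> ?S) = 0" by linarith+
  have f0: "\<forall>s\<in>?S. f s = 0"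
    using zero(1) by (subst (asm) sum_nonneg_eq_0_iff) (use f in auto)
  have g0: "\<forall>t\<in>?S. g t = 0"
    using zero(2) by (subst (asm) sum_nonneg_eq_0_iff) (use g in auto)
  have e0: "\<forall>z\<in>?S \<times> ?S. e z = 0"
    using zero(3) by (subst (asm) sum_nonneg_eq_0_iff) (use e in auto)
  show "\<And>s. s < 3 * N \<Longrightarrow> (\<Sum>t<3 * N. pmf \<mu> (s, t) * bonus s t) = 0"
    and "\<And>t. t < 3 * N \<Longrightarrow> (\<Sum>s<3 * N. pmf \<mu> (s, t) * bonus t s) = 0"
    using f0 g0 by (simp_all add: f_def g_def)
  fix s t assume st: "(s, t) \<in> set_pmf \<mu>"
  then have "(s, t) \<in> ?S \<times> ?S" using assms by (auto simp: correlated_equilibrium_def)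
  then have "e (s, t) = 0" using e0 by blast
  then show "bonus s t + bonus t s = 0" using st by (auto simp: e_def set_pmf_iff)
qed

lemma correlated_payoff:
  assumes "correlated_equilibrium game \<mu>"
  shows "expected_payoff1 game \<mu> = (\<Sum>z\<in>profiles game. pmf \<mu> z * X (snd z))"
    and "expected_payoff2 game \<mu> = (\<Sum>z\<in>profiles game. pmf \<mu> z * Y (fst z))"
proof -
  note D = correlated_equilibriumD(2,3)[OF assms]
  have "(\<Sum>s<3 * N. \<Sum>t<3 * N. pmf \<mu> (s, t) * bonus t s) = (\<Sum>t<3 * N. \<Sum>s<3 * N. pmf \<mu> (s, t) * bonus t s)"
    by (rule sum.swap)
  then have "(\<Sum>s<3 * N. \<Sum>t<3 * N. pmf \<mu> (s, t) * bonus t s) = 0" using D(2) by simp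
  then show "expected_payoff2 game \<mu> = (\<Sum>z\<in>profiles game. pmf \<mu> z * Y (fst z))"
    unfolding expected_payoff2_def game_simps sum.cartesian_product'
    by (simp add: distrib_left sum.distrib)
  have "(\<Sum>s<3 * N. \<Sum>t<3 * N. pmf \<mu> (s, t) * bonus s t) = 0" using D(1) by simp
  then show "expected_payoff1 game \<mu> = (\<Sum>z\<in>profiles game. pmf \<mu> z * X (snd z))"
    unfolding expected_payoff1_def game_simps sum.cartesian_product'
    by (simp add: distrib_left sum.distrib)
qed

text \<open>With the expected bonuses gone, the payoff pair is the mean of the points
  \<open>(X t, Y s)\<close> over the support, which meets diagonal blocks only.\<close>

lemma CEP_subset:
  assumes "convex P" and P: "\<And>s t. s < 3 * N \<Longrightarrow> t < 3 * N \<Longrightarrow> s div 3 = t div 3 \<Longrightarrow> (X t, Y s) \<in> P"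
  shows "CEP game \<subseteq> P"
proof
  fix p assume "p \<in> CEP game"
  then obtain \<mu> where ce: "correlated_equilibrium game \<mu>"
    and p: "p = (expected_payoff1 game \<mu>, expected_payoff2 game \<mu>)"
    unfolding CEP_def by blast
  have supp: "set_pmf \<mu> \<subseteq> profiles game" using ce by (simp add: correlated_equilibrium_def)
  have fin: "finite (set_pmf \<mu>)" using finite_subset[OF supp] by simp
  have restr: "(\<Sum>z\<in>profiles game. pmf \<mu> z * f z) = (\<Sum>z\<in>set_pmf \<mu>. pmf \<mu> z * f z)" for f
    using supp by (intro sum.mono_neutral_right) (auto simp: set_pmf_iff)
  have "(\<Sum>z\<in>set_pmf \<mu>. pmf \<mu> z *\<^sub>R (X (snd z), Y (fst z))) \<in> P"
  proof (rule convex_sum[OF fin assms(1)])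
    show "sum (pmf \<mu>) (set_pmf \<mu>) = 1" by (rule sum_pmf_eq_1[OF fin order_refl])
    fix z assume z: "z \<in> set_pmf \<mu>"
    then have "(fst z, snd z) \<in> profiles game" "fst z div 3 = snd z div 3"
      using supp bonus_sum_eq_0(1)[OF correlated_equilibriumD(1)[OF ce, of "fst z" "snd z"]] by auto
    then show "(X (snd z), Y (fst z)) \<in> P" using P by auto
  qed simp
  also have "(\<Sum>z\<in>set_pmf \<mu>. pmf \<mu> z *\<^sub>R (X (snd z), Y (fst z))) = p"
    unfolding p correlated_payoff[OF ce] restr by (simp add: prod_eq_iff fst_sum snd_sum)
  finally show "p \<in> P" .
qed

section \<open>Vertex blocks: rock-paper-scissors with punished ties\<close>

lemma bonus_block:
  assumes "K \<le> k" "i < 3" "j < 3"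
  shows "bonus (3 * k + i) (3 * k + j) = (if i = (j + 1) mod 3 then 1 else -1)"
proof -
  have "(3 * k + i) div 3 = k" "(3 * k + j) div 3 = k" "(3 * k + i) mod 3 = i" using assms by simp_all
  moreover have "(3 * k + j + 1) mod 3 = (j + 1) mod 3"
    using mod_mult_self4[of 3 k "j + 1"] by (simp only: add.assoc)
  ultimately show ?thesis using assms by (simp add: bonus_def)
qed

text \<open>Told to play \<open>s\<close>, a player faces the other two strategies of the block with
  equal weight. \<open>s\<close> beats one and loses to the other. A deviation inside the block ties
  against itself and gains at most 1 from the remaining strategy; a deviation outside never has a
  positive bonus.\<close>

lemma vertex_block_sums:
  assumes "K \<le> k" "s div 3 = k"
  shows "(\<Sum>t\<in>{3 * k..<3 * k + 3} - {s}. bonus s t) = 0"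
    and "(\<Sum>t\<in>{3 * k..<3 * k + 3} - {s}. bonus s' t) \<le> 0"
proof -
  have three: "i = 0 \<or> i = 1 \<or> i = 2" if "i < 3" for i :: nat using that by linarith
  define i where "i = s mod 3"
  have i: "s = 3 * k + i" "i < 3" using assms(2) by (auto simp: i_def)
  \<comment> \<open>The two strategies other than \<open>s\<close> have the cyclic successors of its
    index, so the claims reduce to evaluation for each index.\<close>
  have sum: "(\<Sum>t\<in>{3 * k..<3 * k + 3} - {s}. f t) = f (3 * k + (i + 1) mod 3) + f (3 * k + (i + 2) mod 3)"
    for f :: "nat \<Rightarrow> real"
  proof -
    have "{3 * k..<3 * k + 3} - {s} = {3 * k + (i + 1) mod 3, 3 * k + (i + 2) mod 3}"
      using three[OF i(2)] unfolding i(1) by (elim disjE) auto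
    moreover have "3 * k + (i + 1) mod 3 \<noteq> 3 * k + (i + 2) mod 3"
      using three[OF i(2)] by (elim disjE) simp_all
    ultimately show ?thesis by simp
  qed
  have block_sum: "(\<Sum>t\<in>{3 * k..<3 * k + 3} - {s}. bonus (3 * k + j) t) =
      (if j = ((i + 1) mod 3 + 1) mod 3 then 1 else -1) + (if j = ((i + 2) mod 3 + 1) mod 3 then 1 else -1)"
    if "j < 3" for j
    unfolding sum using bonus_block[OF assms(1) that] by simp
  show "(\<Sum>t\<in>{3 * k..<3 * k + 3} - {s}. bonus s t) = 0"
    using block_sum[OF i(2)] three[OF i(2)] unfolding i(1) by (elim disjE) simp_all
  show "(\<Sum>t\<in>{3 * k..<3 * k + 3} - {s}. bonus s' t) \<le> 0"
  proof (cases "s' div 3 = k")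
    case True
    define j where "j = s' mod 3"
    have j: "s' = 3 * k + j" "j < 3" using True by (auto simp: j_def)
    show ?thesis
      using block_sum[OF j(2)] three[OF i(2)] three[OF j(2)] unfolding j(1) by (elim disjE) simp_all
  next
    case False
    have "t div 3 = k" if "t \<in> {3 * k..<3 * k + 3}" for t using that by auto
    with False show ?thesis by (intro sum_nonpos) (auto simp: bonus_def)
  qed
qed

lemma vertex_in_CEP:
  assumes "K \<le> k" "k < N" and XY: "\<And>n. n div 3 = k \<Longrightarrow> X n = x \<and> Y n = y"
  shows "(x, y) \<in> CEP game"
proof -
  define B where "B = {3 * k..<3 * k + 3}"
  define E where "E = {(s, t) \<in> B \<times> B. s \<noteq> t}"
  \<comment> \<open>Uniform play on the six pairs of the block without ties: every recommendation
    leaves the opponent uniform on the other two strategies.\<close>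
  define \<mu> where "\<mu> = pmf_of_set E"
  have B: "s div 3 = k" "s < 3 * N" if "s \<in> B" for s using that assms(2) by (auto simp: B_def)
  have "E \<subseteq> B \<times> B" by (auto simp: E_def)
  then have "finite E" by (rule finite_subset) (simp add: B_def)
  have "(3 * k, 3 * k + 1) \<in> E" by (simp add: E_def B_def)
  then have "E \<noteq> {}" by blast
  have supp: "set_pmf \<mu> = E" using \<open>finite E\<close> \<open>E \<noteq> {}\<close> by (simp add: \<mu>_def)
  define q where "q = 1 / real (card E)"
  have q: "0 \<le> q" by (simp add: q_def)
  have pmf: "pmf \<mu> z = (if z \<in> E then q else 0)" for z
    using \<open>finite E\<close> \<open>E \<noteq> {}\<close> by (simp add: \<mu>_def q_def indicator_def)
  have row: "(\<Sum>t<3 * N. pmf \<mu> (s, t) * f t) = (if s \<in> B then q * (\<Sum>t\<in>B - {s}. f t) else 0)" for s f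
  proof -
    have "(\<Sum>t<3 * N. pmf \<mu> (s, t) * f t) = (\<Sum>t\<in>B - {s}. q * f t)" if "s \<in> B"
      using that B(2) by (intro sum.mono_neutral_cong_right) (auto simp: pmf E_def)
    then show ?thesis by (auto simp: sum_distrib_left pmf E_def)
  qed
  have col: "(\<Sum>s<3 * N. pmf \<mu> (s, t) * f s) = (if t \<in> B then q * (\<Sum>s\<in>B - {t}. f s) else 0)" for t f
  proof -
    have "(\<Sum>s<3 * N. pmf \<mu> (s, t) * f s) = (\<Sum>s\<in>B - {t}. q * f s)" if "t \<in> B"
      using that B(2) by (intro sum.mono_neutral_cong_right) (auto simp: pmf E_def)
    then show ?thesis by (auto simp: sum_distrib_left pmf E_def)
  qed
  have dev: "0 \<le> (\<Sum>t\<in>B - {s}. bonus s t - bonus s' t)" if "s \<in> B" for s s'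
    using vertex_block_sums(1)[OF assms(1) B(1)[OF that]] vertex_block_sums(2)[OF assms(1) B(1)[OF that], of s']
    by (simp add: sum_subtractf B_def)
  have ce: "correlated_equilibrium game \<mu>"
    unfolding correlated_equilibrium_def
  proof (intro conjI ballI)
    show "set_pmf \<mu> \<subseteq> profiles game" using B(2) by (auto simp: supp E_def)
    fix s s' :: nat
    show "0 \<le> (\<Sum>t\<in>strats2 game. pmf \<mu> (s, t) * (payoff1 game (s, t) - payoff1 game (s', t)))"
      using dev q by (simp add: row)
    show "0 \<le> (\<Sum>r\<in>strats1 game. pmf \<mu> (r, s) * (payoff2 game (r, s) - payoff2 game (r, s')))"
      using dev q by (simp add: col)
  qed
  have fin: "finite (profiles game)" by simp
  have sub: "set_pmf \<mu> \<subseteq> profiles game" using ce by (simp add: correlated_equilibrium_def)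
  have const: "X (snd z) = x" "Y (fst z) = y" if "z \<in> set_pmf \<mu>" for z
  proof -
    have "fst z \<in> B" "snd z \<in> B" using that by (auto simp: supp E_def)
    then show "X (snd z) = x" "Y (fst z) = y" using XY B(1) by blast+
  qed
  \<comment> \<open>In a correlated equilibrium only the terms \<open>X\<close> and \<open>Y\<close>
    contribute to the expectation, and these are constant on the block.\<close>
  have "expected_payoff1 game \<mu> = x" "expected_payoff2 game \<mu> = y"
    unfolding correlated_payoff[OF ce] by (rule pmf_average_const[OF fin sub], erule const)+
  with ce show ?thesis unfolding CEP_def by blast
qed

section \<open>Nash equilibria of the block game\<close>

definition block :: "nat \<Rightarrow> nat set" where
  "block k = {3 * k..<3 * k + 3}"

lemma block_iff: "n \<in> block k \<longleftrightarrow> n div 3 = k"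
  by (auto simp: block_def)

lemma nash_in_rectangle_block:
  assumes "nash_equilibrium game \<sigma> \<tau>"
  obtains k where "k < K" "set_pmf \<sigma> \<subseteq> block k" "set_pmf \<tau> \<subseteq> block k"
proof -
  note ce = nash_imp_correlated[OF bimatrix_game_game assms]
  have fin: "finite {..<3 * N}" by simp
  have sub: "set_pmf \<sigma> \<subseteq> {..<3 * N}" "set_pmf \<tau> \<subseteq> {..<3 * N}"
    using assms by (simp_all add: nash_equilibrium_def)
  have zero: "bonus s t + bonus t s = 0" if "s \<in> set_pmf \<sigma>" "t \<in> set_pmf \<tau>" for s t
    using correlated_equilibriumD(1)[OF ce, of s t] that by simp
  obtain s0 where s0: "s0 \<in> set_pmf \<sigma>" using set_pmf_not_empty[of \<sigma>] by blast
  obtain t0 where t0: "t0 \<in> set_pmf \<tau>" using set_pmf_not_empty[of \<tau>] by blast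
  define k where "k = s0 div 3"
  have \<tau>k: "t div 3 = k" if "t \<in> set_pmf \<tau>" for t
    using bonus_sum_eq_0(1)[OF zero[OF s0 that]] by (simp add: k_def)
  have \<sigma>k: "s div 3 = k" if "s \<in> set_pmf \<sigma>" for s
    using bonus_sum_eq_0(1)[OF zero[OF that t0]] \<tau>k[OF t0] by simp
  have "k < K"
  proof (rule ccontr)
    assume "\<not> k < K"
    then have disj: "s \<noteq> t" if "s \<in> set_pmf \<sigma>" "t \<in> set_pmf \<tau>" for s t
      using bonus_sum_eq_0(2)[OF zero[OF that]] \<sigma>k[OF that(1)] by auto
    have pm: "bonus s t = 1 \<or> bonus s t = -1" if "s div 3 = k" "t div 3 = k" for s t
      using that \<open>\<not> k < K\<close> by (simp add: bonus_def)
    \<comment> \<open>In a vertex block every bonus is 1 or -1, so an opponent against whom the mean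
      bonus is 0 cannot play a pure strategy.\<close>
    have both: "\<exists>j\<in>set_pmf \<rho>. \<exists>j'\<in>set_pmf \<rho>. j \<noteq> j'"
      if "set_pmf \<rho> \<subseteq> {..<3 * N}" "\<forall>j\<in>set_pmf \<rho>. j div 3 = k" "i div 3 = k"
        "(\<Sum>j<3 * N. pmf \<rho> j * bonus i j) = 0" for \<rho> i
    proof (rule ccontr)
      assume *: "\<not> ?thesis"
      obtain j where j: "j \<in> set_pmf \<rho>" using set_pmf_not_empty[of \<rho>] by blast
      have "(\<Sum>j<3 * N. pmf \<rho> j * bonus i j) = bonus i j"
      proof (rule pmf_average_const[OF fin that(1)])
        fix j' assume "j' \<in> set_pmf \<rho>"
        with * j have "j' = j" by blast
        then show "bonus i j' = bonus i j" by simp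
      qed
      with pm[of i j] that j show False by auto
    qed
    have "pmf \<sigma> s0 * (\<Sum>t<3 * N. pmf \<tau> t * bonus s0 t) = 0"
      using correlated_equilibriumD(2)[OF ce, of s0] s0 sub(1)
      by (auto simp: pmf_pair sum_distrib_left mult.assoc)
    then have "(\<Sum>t<3 * N. pmf \<tau> t * bonus s0 t) = 0" using s0 by (simp add: set_pmf_iff)
    from both[OF sub(2) _ _ this] obtain t t' where t: "t \<in> set_pmf \<tau>" "t' \<in> set_pmf \<tau>" "t \<noteq> t'"
      using \<tau>k \<sigma>k[OF s0] by blast
    have "pmf \<tau> t0 * (\<Sum>s<3 * N. pmf \<sigma> s * bonus t0 s) = 0"
      using correlated_equilibriumD(3)[OF ce, of t0] t0 sub(2)
      by (auto simp: pmf_pair sum_distrib_left mult_ac)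
    then have "(\<Sum>s<3 * N. pmf \<sigma> s * bonus t0 s) = 0" using t0 by (simp add: set_pmf_iff)
    from both[OF sub(1) _ _ this] obtain s s' where s: "s \<in> set_pmf \<sigma>" "s' \<in> set_pmf \<sigma>" "s \<noteq> s'"
      using \<sigma>k \<tau>k[OF t0] by blast
    \<comment> \<open>Two disjoint supports with two strategies each would need four strategies, but
      a block has three.\<close>
    have "card {s, s', t, t'} = 4" using s t disj by simp
    moreover have "card {s, s', t, t'} \<le> card (block k)"
      using s t \<sigma>k \<tau>k by (intro card_mono) (auto simp: block_iff, simp add: block_def)
    ultimately show False by (simp add: block_def)
  qed
  then show thesis using \<sigma>k \<tau>k by (intro that) (auto simp: block_iff)
qed

text \<open>Against an opponent inside block \<open>k\<close>, strategies of the block have bonus 0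
  and all others at most 0, while the term chosen by the opponent is the same for every
  reply.\<close>

lemma nash_of_rectangle_block:
  assumes "k < K" "set_pmf \<sigma> \<subseteq> block k" "set_pmf \<tau> \<subseteq> block k"
  shows "nash_equilibrium game \<sigma> \<tau>"
proof -
  have sub: "block k \<subseteq> {..<3 * N}" using assms(1) K(2) by (auto simp: block_def)
  have eq: "(\<Sum>j<3 * N. pmf \<rho> j * bonus i j) = 0" if "set_pmf \<rho> \<subseteq> block k" "i \<in> block k" for \<rho> i
    using that assms(1)
    by (intro pmf_average_const[OF _ subset_trans[OF that(1) sub]]) (auto simp: bonus_def block_iff subset_iff)
  have le: "(\<Sum>j<3 * N. pmf \<rho> j * bonus i j) \<le> 0" if "set_pmf \<rho> \<subseteq> block k" for \<rho> i
  proof (intro sum_nonpos)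
    fix j
    have "bonus i j \<le> 0" if "j div 3 = k" using that assms(1) by (auto simp: bonus_def)
    then show "pmf \<rho> j * bonus i j \<le> 0"
      using that by (cases "j \<in> set_pmf \<rho>") (auto simp: set_pmf_iff block_iff subset_iff mult_nonneg_nonpos)
  qed
  show ?thesis
    unfolding nash_equilibrium_iff[OF bimatrix_game_game] reply_payoff1_def reply_payoff2_def
    using assms(2,3) sub eq[OF assms(2)] eq[OF assms(3)] le[OF assms(2)] le[OF assms(3)]
    by (simp add: distrib_left sum.distrib subset_iff)
qed

text \<open>Any two mixed strategies of a rectangle block form an equilibrium, so the averages of
  \<open>X\<close> under \<tau> and of \<open>Y\<close> under \<sigma> vary independently.\<close>

lemma NEP_game:
  "NEP game = (\<Union>k<K. (\<lambda>\<tau>. \<Sum>t<3 * N. pmf \<tau> t * X t) ` {\<tau>. set_pmf \<tau> \<subseteq> block k} \<times>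
     (\<lambda>\<sigma>. \<Sum>s<3 * N. pmf \<sigma> s * Y s) ` {\<sigma>. set_pmf \<sigma> \<subseteq> block k})"
proof -
  have pay: "expected_payoff1 game (pair_pmf \<sigma> \<tau>) = (\<Sum>t<3 * N. pmf \<tau> t * X t)"
    "expected_payoff2 game (pair_pmf \<sigma> \<tau>) = (\<Sum>s<3 * N. pmf \<sigma> s * Y s)"
    if ne: "nash_equilibrium game \<sigma> \<tau>" for \<sigma> \<tau>
  proof -
    have sub: "set_pmf \<sigma> \<subseteq> {..<3 * N}" "set_pmf \<tau> \<subseteq> {..<3 * N}"
      using ne by (simp_all add: nash_equilibrium_def)
    have one: "(\<Sum>s<3 * N. pmf \<sigma> s) = 1" "(\<Sum>t<3 * N. pmf \<tau> t) = 1"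
      using sum_pmf_eq_1[OF _ sub(1)] sum_pmf_eq_1[OF _ sub(2)] by simp_all
    note ce = nash_imp_correlated[OF bimatrix_game_game ne]
    have "expected_payoff1 game (pair_pmf \<sigma> \<tau>) = (\<Sum>s<3 * N. \<Sum>t<3 * N. pmf \<sigma> s * (pmf \<tau> t * X t))"
      unfolding correlated_payoff[OF ce] game_simps sum.cartesian_product' by (simp add: pmf_pair mult.assoc)
    also have "\<dots> = (\<Sum>s<3 * N. pmf \<sigma> s) * (\<Sum>t<3 * N. pmf \<tau> t * X t)"
      by (simp add: sum_product)
    finally show "expected_payoff1 game (pair_pmf \<sigma> \<tau>) = (\<Sum>t<3 * N. pmf \<tau> t * X t)" using one by simp
    have "expected_payoff2 game (pair_pmf \<sigma> \<tau>) = (\<Sum>s<3 * N. \<Sum>t<3 * N. (pmf \<sigma> s * Y s) * pmf \<tau> t)"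
      unfolding correlated_payoff[OF ce] game_simps sum.cartesian_product' by (simp add: pmf_pair mult_ac)
    also have "\<dots> = (\<Sum>s<3 * N. pmf \<sigma> s * Y s) * (\<Sum>t<3 * N. pmf \<tau> t)"
      by (simp add: sum_product)
    finally show "expected_payoff2 game (pair_pmf \<sigma> \<tau>) = (\<Sum>s<3 * N. pmf \<sigma> s * Y s)" using one by simp
  qed
  show ?thesis
  proof (intro equalityI subsetI)
    fix z assume "z \<in> NEP game"
    then obtain \<sigma> \<tau> where z: "z = (expected_payoff1 game (pair_pmf \<sigma> \<tau>), expected_payoff2 game (pair_pmf \<sigma> \<tau>))"
      and ne: "nash_equilibrium game \<sigma> \<tau>"
      unfolding NEP_def by blast
    obtain k where "k < K" "set_pmf \<sigma> \<subseteq> block k" "set_pmf \<tau> \<subseteq> block k"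
      by (rule nash_in_rectangle_block[OF ne])
    then show "z \<in> (\<Union>k<K. (\<lambda>\<tau>. \<Sum>t<3 * N. pmf \<tau> t * X t) ` {\<tau>. set_pmf \<tau> \<subseteq> block k} \<times>
     (\<lambda>\<sigma>. \<Sum>s<3 * N. pmf \<sigma> s * Y s) ` {\<sigma>. set_pmf \<sigma> \<subseteq> block k})"
      unfolding z pay[OF ne] by blast
  next
    fix z assume "z \<in> (\<Union>k<K. (\<lambda>\<tau>. \<Sum>t<3 * N. pmf \<tau> t * X t) ` {\<tau>. set_pmf \<tau> \<subseteq> block k} \<times>
     (\<lambda>\<sigma>. \<Sum>s<3 * N. pmf \<sigma> s * Y s) ` {\<sigma>. set_pmf \<sigma> \<subseteq> block k})"
    then obtain k \<sigma> \<tau> where k: "k < K" "set_pmf \<sigma> \<subseteq> block k" "set_pmf \<tau> \<subseteq> block k"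
      and z: "z = (\<Sum>t<3 * N. pmf \<tau> t * X t, \<Sum>s<3 * N. pmf \<sigma> s * Y s)"
      by blast
    have ne: "nash_equilibrium game \<sigma> \<tau>" by (rule nash_of_rectangle_block[OF k])
    show "z \<in> NEP game" unfolding z pay[OF ne, symmetric] NEP_def using ne by blast
  qed
qed

text \<open>The third strategy of a rectangle block repeats the value \<open>b\<close>; it is there
  to give all blocks the same size.\<close>

lemma block_averages:
  assumes "k < K" "a \<le> b" and V: "\<And>n. n div 3 = k \<Longrightarrow> V n = (if n mod 3 = 0 then a else b)"
  shows "(\<lambda>\<tau>. \<Sum>t<3 * N. pmf \<tau> t * V t) ` {\<tau>. set_pmf \<tau> \<subseteq> block k} = {a..b::real}"
proof (intro equalityI subsetI)
  have sub: "block k \<subseteq> {..<3 * N}" using assms(1) K(2) by (auto simp: block_def)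
  have restr: "(\<Sum>t<3 * N. pmf \<tau> t * v t) = (\<Sum>t\<in>block k. pmf \<tau> t * v t)" if "set_pmf \<tau> \<subseteq> block k" for \<tau> v
    using that sub by (intro sum.mono_neutral_right) (auto simp: set_pmf_iff)
  have fin: "finite (block k)" by (simp add: block_def)
  {
    fix r assume "r \<in> (\<lambda>\<tau>. \<Sum>t<3 * N. pmf \<tau> t * V t) ` {\<tau>. set_pmf \<tau> \<subseteq> block k}"
    then obtain \<tau> where \<tau>: "set_pmf \<tau> \<subseteq> block k" and r: "r = (\<Sum>t<3 * N. pmf \<tau> t * V t)" by blast
    have ab: "V t \<le> b" "- V t \<le> - a" if "t \<in> block k" for t
      using V[of t] that assms(2) by (auto simp: block_iff)
    have "(\<Sum>t\<in>block k. pmf \<tau> t * V t) \<le> b" "(\<Sum>t\<in>block k. pmf \<tau> t * - V t) \<le> - a"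
      by (rule simplex_average_le[OF fin pmf_in_simplex_on[OF fin \<tau>]], erule ab)+
    then show "r \<in> {a..b}" unfolding r restr[OF \<tau>] by (simp add: sum_negf)
  next
    fix r assume r: "r \<in> {a..b}"
    then have "r \<in> closed_segment a b" using assms(2) by (simp add: closed_segment_eq_real_ivl)
    then obtain u where u: "0 \<le> u" "u \<le> 1" "r = (1 - u) * a + u * b"
      by (auto simp: closed_segment_def)
    \<comment> \<open>The first two strategies carry the endpoints \<open>a\<close> and
      \<open>b\<close>, so mixing them already reaches every value in between.\<close>
    let ?A = "{3 * k, Suc (3 * k)}"
    have "(\<lambda>n. if n = 3 * k then 1 - u else u) \<in> simplex_on ?A" using u by (simp add: simplex_on_def)
    from pmf_of_simplex_on[OF _ this] obtain p where p: "set_pmf p \<subseteq> ?A"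
      "\<And>s. s \<in> ?A \<Longrightarrow> pmf p s = (if s = 3 * k then 1 - u else u)"
      by (metis finite.emptyI finite.insertI)
    have "?A \<subseteq> {..<3 * N}" using assms(1) K(2) by auto
    then have "(\<Sum>t<3 * N. pmf p t * V t) = (\<Sum>t\<in>?A. pmf p t * V t)"
      using p(1) by (intro sum.mono_neutral_right) (auto simp: set_pmf_iff)
    also have "\<dots> = r" using p(2) V[of "3 * k"] V[of "Suc (3 * k)"] u(3) by simp
    finally have "(\<Sum>t<3 * N. pmf p t * V t) = r" .
    moreover have "set_pmf p \<subseteq> block k" using p(1) by (auto simp: block_def)
    ultimately show "r \<in> (\<lambda>\<tau>. \<Sum>t<3 * N. pmf \<tau> t * V t) ` {\<tau>. set_pmf \<tau> \<subseteq> block k}" by blast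
  }
qed

end

section \<open>Assembly of the game from the rectangles and the vertices\<close>

theorem corollary5:
  fixes G :: "('a, 'b) bimatrix" and P :: "(real \<times> real) set"
  assumes "bimatrix_game G" and "polytope P" and "NEP G \<subseteq> P"
  shows "\<exists>G' :: (nat, nat) bimatrix. bimatrix_game G' \<and> NEP G' = NEP G \<and> CEP G' = P"
proof -
  obtain K :: nat and a b c d where "K > 0" and abcd: "\<And>k. k < K \<Longrightarrow> a k \<le> b k \<and> c k \<le> d k"
    and NEP: "NEP G = (\<Union>k<K. {a k..b k} \<times> {c k..d k})"
    by (rule NEP_union_of_rectangles[OF assms(1)]) blast
  obtain V where V: "finite V" "P = convex hull V" using assms(2) by (auto simp: polytope_def)
  obtain v where v: "bij_betw v {0..<card V} V" using ex_bij_betw_nat_finite[OF V(1)] by blast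
  define N where "N = K + card V"
  \<comment> \<open>In block \<open>k < K\<close> index 0 selects the lower end of an interval and
    the other indices the upper end. Block \<open>K + m\<close> is constant with value
    \<open>v m\<close>.\<close>
  define X where "X n = (if n div 3 < K then if n mod 3 = 0 then a (n div 3) else b (n div 3)
    else fst (v (n div 3 - K)))" for n
  define Y where "Y n = (if n div 3 < K then if n mod 3 = 0 then c (n div 3) else d (n div 3)
    else snd (v (n div 3 - K)))" for n
  interpret block_game K N X Y by unfold_locales (use \<open>K > 0\<close> in \<open>auto simp: N_def\<close>)
  have "NEP game = NEP G"
    unfolding NEP_game NEP
  proof (intro SUP_cong refl)
    fix k assume "k \<in> {..<K}"
    then have k: "k < K" by simp
    show "(\<lambda>\<tau>. \<Sum>t<3 * N. pmf \<tau> t * X t) ` {\<tau>. set_pmf \<tau> \<subseteq> block k} \<times>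
        (\<lambda>\<sigma>. \<Sum>s<3 * N. pmf \<sigma> s * Y s) ` {\<sigma>. set_pmf \<sigma> \<subseteq> block k} = {a k..b k} \<times> {c k..d k}"
      using k abcd[OF k] by (subst (1 2) block_averages[OF k]) (auto simp: X_def Y_def)
  qed
  moreover have "CEP game = P"
  proof
    have "convex P" using V(2) by simp
    then show "CEP game \<subseteq> P"
    proof (rule CEP_subset)
      fix s t assume st: "s < 3 * N" "t < 3 * N" "s div 3 = t div 3"
      show "(X t, Y s) \<in> P"
      proof (cases "t div 3 < K")
        case True
        \<comment> \<open>Pure profiles of a rectangle block pay a corner of the rectangle. It is a
          Nash payoff of \<open>G\<close>, so it lies in \<open>P\<close> by hypothesis.\<close>
        then have "(X t, Y s) \<in> {a (t div 3)..b (t div 3)} \<times> {c (t div 3)..d (t div 3)}"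
          using abcd[OF True] st(3) by (simp add: X_def Y_def)
        with True have "(X t, Y s) \<in> NEP G" unfolding NEP by blast
        with assms(3) show ?thesis by blast
      next
        case False
        then have "t div 3 - K \<in> {0..<card V}" using st(2) by (auto simp: N_def)
        then have "v (t div 3 - K) \<in> V" using v by (auto simp: bij_betw_def)
        moreover have "(X t, Y s) = v (t div 3 - K)" using False st(3) by (simp add: X_def Y_def)
        ultimately show ?thesis unfolding V(2) by (simp add: hull_inc)
      qed
    qed
    \<comment> \<open>Since the set of correlated payoffs is convex, the generators of
      \<open>P\<close> suffice, and each of them has a block of its own.\<close>
    have "V \<subseteq> CEP game"
    proof
      fix z assume "z \<in> V"
      then obtain m where m: "m < card V" "z = v m"
        using v unfolding bij_betw_def by (metis atLeastLessThan_iff imageE)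
      have "(fst (v m), snd (v m)) \<in> CEP game"
        by (rule vertex_in_CEP[of "K + m"]) (use m in \<open>auto simp: N_def X_def Y_def\<close>)
      then show "z \<in> CEP game" using m by simp
    qed
    then show "P \<subseteq> CEP game"
      unfolding V(2) by (rule hull_minimal) (rule convex_CEP[OF bimatrix_game_game])
  qed
  ultimately show ?thesis using bimatrix_game_game by blast
qed

end
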